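(* Suppose $\gamma>0$ and $\rho=0$. Take $\epsilon\in[0,1)$, $\tau_0,\sigma_0>0$ with $\tau_0\sigma_0\|K\|^2<1$, initialise $\lambda_0:=\mu_0:=1$, and update for $i\in\mathbb N$ $$\tau_{i+1}:=\tau_i\lambda_i^{-1}\lambda_{i+1}\omega_i,\qquad \omega_i:=\frac{\lambda_{i+1}^{-1}-1}{\lambda_i^{-1}-\epsilon},\qquad \sigma_{i+1}:=\sigma_i\lambda_i^{-1}\lambda_{i+1}/\omega_i,$$ $$\mu_{i+1}:=\lambda_{i+1}:=\frac{\sqrt{\lambda_i^2+2\gamma\lambda_i\tau_i}}{1-\epsilon\lambda_i+\sqrt{\lambda_i^2+2\gamma\lambda_i\tau_i}}.$$ Then the iterates $u^N=(x^N,y^N)$ generated by the IC-PDPS algorithm (defined in the context) and the associated auxiliary sequence $\{\zeta^N\}$ satisfy both $\mathcal G_{\gamma,0}(u^N;\widehat u)\to0$ and $\|\zeta^N-\widehat x\|^2\to0$ at the rate $O(1/N^2)$ for any $\widehat u=(\widehat x,\widehat y)\in H^{-1}(0)$.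
   Context: $X,Y$ are (real) Hilbert spaces, $K\in\mathcal L(X;Y)$ is bounded linear, $G:X\to[-\infty,\infty]$ and $F^*:Y\to[-\infty,\infty]$ are convex, proper, lower semicontinuous, and (strongly) convex with factors $\gamma\ge0$ and $\rho\ge0$ respectively (i.e. $G-\frac\gamma2\|\cdot\|^2$ and $F^*-\frac\rho2\|\cdot\|^2$ are convex). $F^*$ is the Fenchel conjugate of a convex, proper, lower semicontinuous $F$. The set $H^{-1}(0)$ consists of the pairs $\widehat u=(\widehat x,\widehat y)\in X\times Y$ with $-K^*\widehat y\in\partial G(\widehat x)$ and $K\widehat x\in\partial F^*(\widehat y)$. $\mathbb N=\{0,1,2,\dots\}$. The proximal map is $\operatorname{prox}_{tG}(v):=\arg\min_x\, tG(x)+\frac12\|x-v\|^2$, i.e. $(I+t\partial G)^{-1}(v)$. IC-PDPS algorithm (inertial, corrected, primal-dual proximal splitting), for given parameters $(\tau_i,\sigma_{i+1},\lambda_i,\mu_{i+1},\omega_i)_{i\in\mathbb N}$: take arbitrary $\tilde x^0:=\bar x^0:=x^0\in X$ and $\tilde y^0:=\bar y^0:=y^0\in\operatorname{dom}\partial F^*$, and for $i=0,1,2,\dots$ set $\tilde\tau_i:=\tau_i/[1+\gamma\tau_i(\lambda_i^{-1}-1)]$, $\tilde\sigma_{i+1}:=\sigma_{i+1}/[1+\rho\sigma_{i+1}(\mu_{i+1}^{-1}-1)]$, $x^i_\gamma:=[\bar x^i+\gamma\tau_i(\lambda_i^{-1}-1)x^i]/[1+\gamma\tau_i(\lambda_i^{-1}-1)]$,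 $x^{i+1}:=\operatorname{prox}_{\tilde\tau_iG}(x^i_\gamma-\tilde\tau_iK^*\tilde y^i)$, $\bar x^{i+1}:=x^{i+1}+\lambda_{i+1}(\lambda_i^{-1}-1)(x^{i+1}-x^i)$, $\tilde x^{i+1}:=x^{i+1}+(\lambda_i^{-1}-1)(x^{i+1}-x^i)$, $y^i_\rho:=[\bar y^i+\rho\sigma_{i+1}(\mu_{i+1}^{-1}-1)y^i]/[1+\rho\sigma_{i+1}(\mu_{i+1}^{-1}-1)]$, $y^{i+1}:=\operatorname{prox}_{\tilde\sigma_{i+1}F^*}(y^i_\rho+\tilde\sigma_{i+1}K[\tilde x^{i+1}+\omega_i(\tilde x^{i+1}-\tilde x^i)])$, $\bar y^{i+1}:=y^{i+1}+\mu_{i+2}(\mu_{i+1}^{-1}-1)(y^{i+1}-y^i)$, $\tilde y^{i+1}:=y^{i+1}+(\mu_{i+1}^{-1}-1)(y^{i+1}-y^i)$. The auxiliary sequence is $z^i=(\zeta^i,\eta^i)$ with $\zeta^0:=x^0$, $\eta^0:=y^0$, $\zeta^{i+1}:=\lambda_i^{-1}x^{i+1}-(\lambda_i^{-1}-1)x^i$, $\eta^{i+1}:=\mu_{i+1}^{-1}y^{i+1}-(\mu_{i+1}^{-1}-1)y^i$. With $G_\gamma(x;\widehat x):=G(x)-\frac\gamma2\|x-\widehat x\|^2$ and $(F^* )_\rho(y;\widehat y):=F^*(y)-\frac\rho2\|y-\widehat y\|^2$, the strong convexity adjusted gap is $$\mathcal G_{\gamma,\rho}(x,y;\widehat x,\widehat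 y):=\bigl(G_\gamma(x;\widehat x)+\langle\widehat y,Kx\rangle-(F^* )_\rho(\widehat y;\widehat y)\bigr)-\bigl(G_\gamma(\widehat x;\widehat x)+\langle y,K\widehat x\rangle-(F^* )_\rho(y;\widehat y)\bigr).$$ *)

theory Defs
  imports "HOL-Analysis.Analysis" "HOL-Library.Landau_Symbols"
begin

section \<open>Convex analysis for extended-real-valued functions\<close>

text \<open>On \<open>ereal\<close> we have \<open>\<infinity> + (-\<infinity>) = \<infinity>\<close>, so the inequality below is
  equivalent to convexity of the epigraph for arbitrary \<open>[-\<infinity>, \<infinity>]\<close>-valued functions.\<close>

definition econvex :: "('a::real_vector \<Rightarrow> ereal) \<Rightarrow> bool" where
  "econvex f \<longleftrightarrow> (\<forall>x y. \<forall>t\<in>{0<..<1::real}.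
     f ((1 - t) *\<^sub>R x + t *\<^sub>R y) \<le> ereal (1 - t) * f x + ereal t * f y)"

definition strongly_econvex :: "real \<Rightarrow> ('a::real_normed_vector \<Rightarrow> ereal) \<Rightarrow> bool" where
  "strongly_econvex \<gamma> f \<longleftrightarrow> econvex (\<lambda>x. f x - ereal (\<gamma> / 2 * (norm x)\<^sup>2))"

definition proper :: "('a \<Rightarrow> ereal) \<Rightarrow> bool" where
  "proper f \<longleftrightarrow> (\<forall>x. f x \<noteq> - \<infinity>) \<and> (\<exists>x. f x \<noteq> \<infinity>)"

definition lsc :: "('a::topological_space \<Rightarrow> ereal) \<Rightarrow> bool" where
  "lsc f \<longleftrightarrow> (\<forall>x. f x \<le> Liminf (at x) f)"

definition fenchel_conjugate :: "('a::real_inner \<Rightarrow> ereal) \<Rightarrow> 'a \<Rightarrow> ereal" where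
  "fenchel_conjugate f q = (SUP x. ereal (q \<bullet> x) - f x)"

definition subdifferential :: "('a::real_inner \<Rightarrow> ereal) \<Rightarrow> 'a \<Rightarrow> 'a set" where
  "subdifferential f x = {q. \<forall>z. f x + ereal (q \<bullet> (z - x)) \<le> f z}"

definition dom_subdifferential :: "('a::real_inner \<Rightarrow> ereal) \<Rightarrow> 'a set" where
  "dom_subdifferential f = {x. subdifferential f x \<noteq> {}}"

definition prox :: "real \<Rightarrow> ('a::real_inner \<Rightarrow> ereal) \<Rightarrow> 'a \<Rightarrow> 'a" where
  "prox t f v = arg_min (\<lambda>x. ereal t * f x + ereal (1 / 2 * (norm (x - v))\<^sup>2)) (\<lambda>_. True)"


section \<open>The saddle point problem\<close>

text \<open>The set \<open>H\<^sup>-\<^sup>1(0)\<close> of primal-dual solutions. The argument \<open>Fs\<close>, here and below,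
  is the conjugate \<open>F\<^sup>*\<close>. The choice-based \<open>adjoint K\<close> is the Hilbert space
  adjoint whenever \<open>K\<close> is bounded and linear between Hilbert spaces.\<close>

definition saddle_points ::
  "('a::real_inner \<Rightarrow> 'b::real_inner) \<Rightarrow> ('a \<Rightarrow> ereal) \<Rightarrow> ('b \<Rightarrow> ereal) \<Rightarrow> ('a \<times> 'b) set" where
  "saddle_points K G Fs =
     {(xh, yh). - adjoint K yh \<in> subdifferential G xh \<and> K xh \<in> subdifferential Fs yh}"

definition convexity_reduced :: "real \<Rightarrow> ('a::real_inner \<Rightarrow> ereal) \<Rightarrow> 'a \<Rightarrow> 'a \<Rightarrow> ereal" where
  "convexity_reduced \<gamma> G x xh = G x - ereal (\<gamma> / 2 * (norm (x - xh))\<^sup>2)"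

text \<open>The strong convexity adjusted gap
  \<open>\<G>\<^bsub>\<gamma>,\<rho>\<^esub>(x, y; xh, yh)\<close>. All terms are finite if \<open>x, xh\<close> lie in the effective
  domain of a proper \<open>G\<close>, and \<open>y, yh\<close> in that of a proper \<open>Fs\<close>.\<close>

definition adjusted_gap ::
  "real \<Rightarrow> real \<Rightarrow> ('a::real_inner \<Rightarrow> 'b::real_inner) \<Rightarrow> ('a \<Rightarrow> ereal) \<Rightarrow> ('b \<Rightarrow> ereal)
     \<Rightarrow> 'a \<times> 'b \<Rightarrow> 'a \<times> 'b \<Rightarrow> ereal" where
  "adjusted_gap \<gamma> \<rho> K G Fs = (\<lambda>(x, y) (xh, yh).
     (convexity_reduced \<gamma> G x xh + ereal (yh \<bullet> K x) - convexity_reduced \<rho> Fs yh yh)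
     - (convexity_reduced \<gamma> G xh xh + ereal (y \<bullet> K xh) - convexity_reduced \<rho> Fs y yh))"


section \<open>The IC-PDPS algorithm\<close>

text \<open>The step lengths
  \<open>\<tau> / (1 + \<gamma> \<tau> (lam\<^sup>-\<^sup>1 - 1))\<close> and the base points
  \<open>(xb + \<gamma> \<tau> (lam\<^sup>-\<^sup>1 - 1) x) / (1 + \<gamma> \<tau> (lam\<^sup>-\<^sup>1 - 1))\<close> have the same form
  in the primal and in the dual step.\<close>

definition corrected_step :: "real \<Rightarrow> real \<Rightarrow> real \<Rightarrow> real" where
  "corrected_step \<gamma> \<tau> lam = \<tau> / (1 + \<gamma> * \<tau> * (inverse lam - 1))"

definition corrected_base :: "real \<Rightarrow> real \<Rightarrow> real \<Rightarrow> 'a::real_vector \<Rightarrow> 'a \<Rightarrow> 'a" where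
  "corrected_base \<gamma> \<tau> lam xb x =
     (xb + (\<gamma> * \<tau> * (inverse lam - 1)) *\<^sub>R x) /\<^sub>R (1 + \<gamma> * \<tau> * (inverse lam - 1))"

text \<open>The sequences \<open>xb, yb\<close> are the \<open>x\<close>- and \<open>y\<close>-sequences with a bar and \<open>xt, yt\<close>
  those with a tilde. The equations determine all six sequences from \<open>x 0\<close> and \<open>y 0\<close>.\<close>

locale ic_pdps =
  fixes \<gamma> \<rho> :: real
    and K :: "'a::{real_inner, complete_space} \<Rightarrow> 'b::{real_inner, complete_space}"
    and G :: "'a \<Rightarrow> ereal"
    and Fs :: "'b \<Rightarrow> ereal"
    and \<tau> \<sigma> lam \<mu> \<omega> :: "nat \<Rightarrow> real"
    and x xb xt :: "nat \<Rightarrow> 'a"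
    and y yb yt :: "nat \<Rightarrow> 'b"
  assumes x_init: "xt 0 = x 0" "xb 0 = x 0"
    and y_init: "yt 0 = y 0" "yb 0 = y 0" "y 0 \<in> dom_subdifferential Fs"
    and x_step: "x (Suc i) =
      prox (corrected_step \<gamma> (\<tau> i) (lam i)) G
        (corrected_base \<gamma> (\<tau> i) (lam i) (xb i) (x i)
          - corrected_step \<gamma> (\<tau> i) (lam i) *\<^sub>R adjoint K (yt i))"
    and xb_step: "xb (Suc i) =
      x (Suc i) + (lam (Suc i) * (inverse (lam i) - 1)) *\<^sub>R (x (Suc i) - x i)"
    and xt_step: "xt (Suc i) = x (Suc i) + (inverse (lam i) - 1) *\<^sub>R (x (Suc i) - x i)"
    and y_step: "y (Suc i) =
      prox (corrected_step \<rho> (\<sigma> (Suc i)) (\<mu> (Suc i))) Fs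
        (corrected_base \<rho> (\<sigma> (Suc i)) (\<mu> (Suc i)) (yb i) (y i)
          + corrected_step \<rho> (\<sigma> (Suc i)) (\<mu> (Suc i)) *\<^sub>R
              K (xt (Suc i) + \<omega> i *\<^sub>R (xt (Suc i) - xt i)))"
    and yb_step: "yb (Suc i) =
      y (Suc i) + (\<mu> (Suc (Suc i)) * (inverse (\<mu> (Suc i)) - 1)) *\<^sub>R (y (Suc i) - y i)"
    and yt_step: "yt (Suc i) = y (Suc i) + (inverse (\<mu> (Suc i)) - 1) *\<^sub>R (y (Suc i) - y i)"

text \<open>The primal part \<open>\<zeta>\<close> of the auxiliary sequence.\<close>

fun aux_seq :: "(nat \<Rightarrow> real) \<Rightarrow> (nat \<Rightarrow> 'a::real_vector) \<Rightarrow> nat \<Rightarrow> 'a" where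
  "aux_seq lam x 0 = x 0"
| "aux_seq lam x (Suc i) = inverse (lam i) *\<^sub>R x (Suc i) - (inverse (lam i) - 1) *\<^sub>R x i"

end

theory Submission
  imports Defs
begin

text \<open>Write \<open>X = \<zeta> - xh\<close>, \<open>Y = \<eta> - yh\<close>; the \<open>\<eta>\<close>-sequence coincides with \<open>yt\<close>, just as
  \<open>\<zeta>\<close> coincides with \<open>xt\<close>. The gap is the sum of two nonnegative Bregman-type excesses \<open>g\<close>,
  \<open>f\<close> of \<open>G\<close> and \<open>Fs\<close> over their linearisations at the saddle point. With
  \<open>b (i + 1) = b i / \<omega> i\<close>, \<open>b 0 = 1\<close>, and \<open>\<phi> = b / lam\<close>, testing the primal and dual
  optimality conditions with \<open>\<phi>\<close> shows that the energy
  \<open>b\<^sup>2 \<parallel>X\<parallel>\<^sup>2 / (2 \<tau>\<^sub>0) + \<parallel>Y\<parallel>\<^sup>2 / (2 \<sigma>\<^sub>0) - b \<langle>K X, Y\<rangle>\<close> plus suitably weighted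
  excesses does not increase, because the parameter rules amount to
  \<open>b'\<^sup>2 = b\<^sup>2 + 2 \<gamma> \<tau>\<^sub>0 b\<close>, \<open>\<tau> b = \<tau>\<^sub>0 lam\<close>, \<open>\<sigma> = \<sigma>\<^sub>0 b lam\<close> and
  \<open>\<phi>' (1 - lam') = \<phi> - \<epsilon> b\<close>. The first relation makes \<open>b\<close> grow at least linearly, the last
  one makes \<open>\<phi>\<close> grow at least quadratically.\<close>

section \<open>Proximal maps on Hilbert spaces\<close>

text \<open>\<open>lsc\<close> is stated with the punctured filter \<open>at p\<close>. Since also
  \<open>c < f p\<close>, the bound \<open>c < f z\<close> extends to all of \<open>nhds p\<close>,
  so the sequence \<open>u\<close> may take the value \<open>p\<close>.\<close>

lemma lsc_le_limit:
  assumes "lsc f" and "u \<longlonglongrightarrow> p" and "a \<longlonglongrightarrow> l" and "\<And>n. f (u n) \<le> a n"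
  shows "f p \<le> l"
proof (rule ccontr)
  assume "\<not> f p \<le> l"
  then obtain c where c: "l < c" "c < f p"
    using dense[of l "f p"] by (metis not_le)
  have "c < Liminf (at p) f"
    using c assms(1) unfolding lsc_def by (meson less_le_trans)
  then have "\<forall>\<^sub>F z in at p. c < f z"
    using less_LiminfD by blast
  then have "\<forall>\<^sub>F z in nhds p. c < f z"
    using c by (auto simp: eventually_at_filter elim!: eventually_mono)
  then have "\<forall>\<^sub>F n in sequentially. c < f (u n)"
    using assms(2) by (auto simp: filterlim_iff)
  moreover have "\<forall>\<^sub>F n in sequentially. a n < c"
    using order_tendstoD(2)[OF assms(3) c(1)] .
  ultimately have "\<forall>\<^sub>F n in sequentially. False"
  proof eventually_elim
    case (elim n)
    then show ?case using assms(4)[of n] by auto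
  qed
  then show False by simp
qed

text \<open>\<open>real_of_ereal\<close> sends \<open>\<infinity>\<close> to 0, so the real
  inequality says nothing about membership in the domain; finiteness at \<open>z\<close> is a
  separate conclusion for that reason.\<close>

lemma econvexD_real:
  assumes "econvex f" "proper f" "f x \<noteq> \<infinity>" "f y \<noteq> \<infinity>" "0 < t" "t < (1::real)"
  defines "z \<equiv> (1 - t) *\<^sub>R x + t *\<^sub>R y"
  shows "f z \<noteq> \<infinity>"
    and "real_of_ereal (f z) \<le> (1 - t) * real_of_ereal (f x) + t * real_of_ereal (f y)"
proof -
  have le: "f z \<le> ereal (1 - t) * f x + ereal t * f y"
    using assms unfolding econvex_def by auto
  have "f x \<noteq> -\<infinity>" "f y \<noteq> -\<infinity>" "f z \<noteq> -\<infinity>"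
    using assms(2) unfolding proper_def by auto
  with le assms(3,4) show "f z \<noteq> \<infinity>"
    and "real_of_ereal (f z) \<le> (1 - t) * real_of_ereal (f x) + t * real_of_ereal (f y)"
    by (cases "f x"; cases "f y"; cases "f z"; simp)+
qed

lemma ereal_real_proper:
  assumes "proper f" "f x \<noteq> \<infinity>"
  shows "f x = ereal (real_of_ereal (f x))"
  using assms unfolding proper_def by (cases "f x") auto

lemma norm_sq_convex_combination:
  fixes x y :: "'a::real_inner"
  shows "(norm ((1 - t) *\<^sub>R x + t *\<^sub>R y))\<^sup>2
    = (1 - t) * (norm x)\<^sup>2 + t * (norm y)\<^sup>2 - t * (1 - t) * (norm (y - x))\<^sup>2"
  by (simp add: power2_norm_eq_inner inner_simps inner_commute[of y x] algebra_simps)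

text \<open>Along a segment the squared norm falls below its chord by exactly
  \<open>t * (1 - t) * (norm (y - x))\<^sup>2\<close>; adding the subtracted quadratic back yields
  the extra term.\<close>

lemma strongly_econvexD_real:
  fixes f :: "'a::real_inner \<Rightarrow> ereal"
  assumes "strongly_econvex \<gamma> f" "proper f" "f x \<noteq> \<infinity>" "f y \<noteq> \<infinity>" "0 < t" "t < (1::real)"
  defines "z \<equiv> (1 - t) *\<^sub>R x + t *\<^sub>R y"
  shows "f z \<noteq> \<infinity>"
    and "real_of_ereal (f z) \<le> (1 - t) * real_of_ereal (f x) + t * real_of_ereal (f y)
      - \<gamma> / 2 * t * (1 - t) * (norm (y - x))\<^sup>2"
proof -
  let ?h = "\<lambda>x. f x - ereal (\<gamma> / 2 * (norm x)\<^sup>2)"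
  have fin: "?h u \<noteq> \<infinity> \<longleftrightarrow> f u \<noteq> \<infinity>" for u
    by (cases "f u") auto
  have re: "real_of_ereal (?h u) = real_of_ereal (f u) - \<gamma> / 2 * (norm u)\<^sup>2"
    if "f u \<noteq> \<infinity>" for u
    using ereal_real_proper[OF assms(2) that] by (metis ereal_minus(1) real_of_ereal.simps(1))
  have pr: "proper ?h"
    unfolding proper_def
  proof
    show "\<forall>u. ?h u \<noteq> - \<infinity>"
    proof
      fix u
      show "?h u \<noteq> - \<infinity>"
        using assms(2) unfolding proper_def by (cases "f u") auto
    qed
    show "\<exists>u. ?h u \<noteq> \<infinity>"
      using assms(3) fin by blast
  qed
  have conv: "econvex ?h"
    using assms(1) unfolding strongly_econvex_def .
  have hx: "?h x \<noteq> \<infinity>" and hy: "?h y \<noteq> \<infinity>"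
    using assms(3,4) fin by blast+
  note D = econvexD_real[OF conv pr hx hy assms(5,6), folded z_def]
  show fz: "f z \<noteq> \<infinity>"
    using D(1) fin by blast
  have "real_of_ereal (f z) - \<gamma> / 2 * (norm z)\<^sup>2
    \<le> (1 - t) * (real_of_ereal (f x) - \<gamma> / 2 * (norm x)\<^sup>2)
      + t * (real_of_ereal (f y) - \<gamma> / 2 * (norm y)\<^sup>2)"
    using D(2) unfolding re[OF fz] re[OF assms(3)] re[OF assms(4)] .
  then show "real_of_ereal (f z) \<le> (1 - t) * real_of_ereal (f x) + t * real_of_ereal (f y)
      - \<gamma> / 2 * t * (1 - t) * (norm (y - x))\<^sup>2"
    unfolding z_def norm_sq_convex_combination
    by (simp add: algebra_simps add_divide_distrib diff_divide_distrib)
qed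

section \<open>Subgradients and strong convexity\<close>

lemma le_of_le_add_small:
  fixes a b c :: real
  assumes "\<And>t. 0 < t \<Longrightarrow> t < 1 \<Longrightarrow> a \<le> b + t * c"
  shows "a \<le> b"
proof (rule tendsto_le[OF _ _ tendsto_const])
  show "((\<lambda>t. b + t * c) \<longlongrightarrow> b) (at_right 0)"
    by (auto intro!: tendsto_eq_intros)
  show "\<forall>\<^sub>F t in at_right 0. a \<le> b + t * c"
    using eventually_at_right_real[OF zero_less_one] by eventually_elim (use assms in auto)
qed simp

lemma subdifferential_finite:
  assumes "proper f" "q \<in> subdifferential f p"
  shows "f p \<noteq> \<infinity>"
proof
  assume "f p = \<infinity>"
  then have "f z = \<infinity>" for z
    using assms(2) unfolding subdifferential_def by (metis (mono_tags, lifting) \<open>f p = \<infinity>\<close> ereal_infty_less_eq(1) mem_Collect_eq plus_ereal.simps(2))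
  then show False
    using assms(1) unfolding proper_def by blast
qed

lemma subdifferentialD_real:
  assumes "proper f" "q \<in> subdifferential f p" "f z \<noteq> \<infinity>"
  shows "real_of_ereal (f p) + q \<bullet> (z - p) \<le> real_of_ereal (f z)"
proof -
  have "f p + ereal (q \<bullet> (z - p)) \<le> f z"
    using assms(2) unfolding subdifferential_def by auto
  then show ?thesis
    using ereal_real_proper[OF assms(1,3)]
      ereal_real_proper[OF assms(1) subdifferential_finite[OF assms(1,2)]]
    by (metis ereal_less_eq(3) plus_ereal.simps(1))
qed

text \<open>Apply the subgradient inequality at \<open>(1 - t) *\<^sub>R p + t *\<^sub>R z\<close>,
  bound the value there by strong convexity and divide by \<open>t\<close>. The quadratic arrives
  with the factor \<open>1 - t\<close>, which tends to 1 as \<open>t\<close> tends to 0.\<close>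

lemma strong_subgradient_inequality:
  fixes f :: "'a::real_inner \<Rightarrow> ereal"
  assumes "strongly_econvex \<gamma> f" "proper f" "q \<in> subdifferential f p" "f z \<noteq> \<infinity>"
  shows "real_of_ereal (f p) + q \<bullet> (z - p) + \<gamma> / 2 * (norm (z - p))\<^sup>2 \<le> real_of_ereal (f z)"
proof (rule le_of_le_add_small)
  fix t :: real
  assume t: "0 < t" "t < 1"
  let ?w = "(1 - t) *\<^sub>R p + t *\<^sub>R z"
  note D = strongly_econvexD_real[OF assms(1,2) subdifferential_finite[OF assms(2,3)] assms(4) t]
  have "?w - p = t *\<^sub>R (z - p)"
    by (simp add: algebra_simps)
  then have "real_of_ereal (f p) + t * (q \<bullet> (z - p)) \<le> real_of_ereal (f ?w)"
    using subdifferentialD_real[OF assms(2,3) D(1)] by simp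
  also note D(2)
  finally have "t * (real_of_ereal (f p) + q \<bullet> (z - p) + \<gamma> / 2 * (norm (z - p))\<^sup>2)
    \<le> t * (real_of_ereal (f z) + t * (\<gamma> / 2 * (norm (z - p))\<^sup>2))"
    by (simp add: algebra_simps diff_divide_distrib)
  then show "real_of_ereal (f p) + q \<bullet> (z - p) + \<gamma> / 2 * (norm (z - p))\<^sup>2
    \<le> real_of_ereal (f z) + t * (\<gamma> / 2 * (norm (z - p))\<^sup>2)"
    using t by simp
qed

section \<open>Existence and optimality for the proximal problem\<close>

text \<open>Direct method: the quadratic term makes a minimising sequence Cauchy, completeness
  supplies its limit, and lower semicontinuity bounds the value there. The minorant may decay
  linearly because the quadratic term dominates it.\<close>

lemma prox_objective_minimizer_exists:
  fixes f :: "'a::{real_inner, complete_space} \<Rightarrow> ereal"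
  assumes conv: "econvex f" and pr: "proper f" and lsc: "lsc f" and t: "0 < t"
    and minorant: "\<And>z. f z \<noteq> \<infinity> \<Longrightarrow> - c - B * norm z \<le> real_of_ereal (f z)"
  obtains p where "f p \<noteq> \<infinity>"
    and "\<And>z. f z \<noteq> \<infinity> \<Longrightarrow> t * real_of_ereal (f p) + 1 / 2 * (norm (p - v))\<^sup>2
      \<le> t * real_of_ereal (f z) + 1 / 2 * (norm (z - v))\<^sup>2"
proof -
  define D where "D = {z. f z \<noteq> \<infinity>}"
  define \<phi> where "\<phi> z = t * real_of_ereal (f z) + 1 / 2 * (norm (z - v))\<^sup>2" for z
  define m where "m = Inf (\<phi> ` D)"
  have ne: "D \<noteq> {}"
    using pr unfolding proper_def D_def by auto
  have bdd: "bdd_below (\<phi> ` D)"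
  proof (rule bdd_belowI2)
    fix z assume "z \<in> D"
    then have "t * (- c - B * norm z) \<le> t * real_of_ereal (f z)"
      using minorant t unfolding D_def by (intro mult_left_mono) auto
    moreover have "B * norm z \<le> \<bar>B\<bar> * (norm (z - v) + norm v)"
      using mult_right_mono[OF abs_ge_self, of "norm z" B]
        mult_left_mono[of "norm z" "norm (z - v) + norm v" "\<bar>B\<bar>"] norm_triangle_sub[of z v]
      by (simp add: add.commute)
    then have "t * (B * norm z) \<le> t * (\<bar>B\<bar> * (norm (z - v) + norm v))"
      using t by simp
    \<comment> \<open>Completing the square in \<open>norm (z - v)\<close> absorbs the linear decay
      and produces the last term of the lower bound.\<close>
    moreover have "0 \<le> (norm (z - v) - t * \<bar>B\<bar>)\<^sup>2" by simp
    ultimately show "- t * c - t * \<bar>B\<bar> * norm v - (t * \<bar>B\<bar>)\<^sup>2 / 2 \<le> \<phi> z"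
      unfolding \<phi>_def by (simp add: power2_eq_square algebra_simps)
  qed
  have m_le: "m \<le> \<phi> z" if "z \<in> D" for z
    unfolding m_def using bdd that by (intro cInf_lower) auto
  have "\<exists>z\<in>D. \<phi> z < m + inverse (real (Suc n))" for n
    using cInf_lessD[of "\<phi> ` D" "m + inverse (real (Suc n))"] ne
    by (auto simp: m_def[symmetric])
  then obtain u where u: "\<And>n. u n \<in> D" "\<And>n. \<phi> (u n) < m + inverse (real (Suc n))"
    by metis
  \<comment> \<open>The value at the midpoint is at least \<open>m\<close>, yet the quadratic term
    pushes it below the mean of the two end values by at least
    \<open>1/8 * (norm (b - a))\<^sup>2\<close>.\<close>
  have mid: "(norm (b - a))\<^sup>2 \<le> 4 * (\<phi> a - m) + 4 * (\<phi> b - m)" if "a \<in> D" "b \<in> D" for a b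
  proof -
    let ?w = "(1 - 1/2) *\<^sub>R a + (1/2) *\<^sub>R b"
    note W = econvexD_real[OF conv pr, of a b "1/2"]
    have "?w \<in> D"
      using W(1) that unfolding D_def by auto
    then have "m \<le> \<phi> ?w" by (rule m_le)
    moreover have "t * real_of_ereal (f ?w)
        \<le> t * ((1 - 1/2) * real_of_ereal (f a) + 1/2 * real_of_ereal (f b))"
      using W(2) that t unfolding D_def by (intro mult_left_mono) auto
    moreover have "?w - v = (1 - 1/2) *\<^sub>R (a - v) + (1/2) *\<^sub>R (b - v)"
      by (simp add: algebra_simps flip: scaleR_add_left)
    then have "(norm (?w - v))\<^sup>2
        = 1/2 * (norm (a - v))\<^sup>2 + 1/2 * (norm (b - v))\<^sup>2 - 1/4 * (norm (b - a))\<^sup>2"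
      using norm_sq_convex_combination[of "1/2" "a - v" "b - v"] by simp
    ultimately show ?thesis
      unfolding \<phi>_def by (simp add: algebra_simps)
  qed
  have "Cauchy u"
  proof (rule metric_CauchyI)
    fix e :: real assume e: "0 < e"
    \<comment> \<open>With both values less than \<open>e\<^sup>2 / 8\<close> above
      \<open>m\<close>, the bound in \<open>mid\<close> adds up to less than
      \<open>e\<^sup>2\<close>.\<close>
    obtain N where N: "inverse (real (Suc N)) < e\<^sup>2 / 8"
      using reals_Archimedean[of "e\<^sup>2 / 8"] e by auto
    have "dist (u i) (u j) < e" if "N \<le> i" "N \<le> j" for i j
    proof -
      have "\<phi> (u k) < m + e\<^sup>2 / 8" if "N \<le> k" for k
      proof -
        have "inverse (real (Suc k)) \<le> inverse (real (Suc N))"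
          using that by (intro le_imp_inverse_le) auto
        then show ?thesis
          using u(2)[of k] N by (meson add_le_cancel_left less_le_trans less_imp_le order.trans)
      qed
      from this[OF that(1)] this[OF that(2)] have "(norm (u i - u j))\<^sup>2 < e\<^sup>2"
        using mid[OF u(1)[of j] u(1)[of i]] by (simp add: field_simps)
      then show ?thesis
        using e by (simp add: dist_norm power_less_imp_less_base)
    qed
    then show "\<exists>M. \<forall>i\<ge>M. \<forall>j\<ge>M. dist (u i) (u j) < e" by blast
  qed
  then obtain p where p: "u \<longlonglongrightarrow> p"
    using Cauchy_convergent convergent_def by blast
  \<comment> \<open>The bound on \<open>\<phi> (u n)\<close> is solved for \<open>f (u n)\<close>:
    semicontinuity concerns \<open>f\<close> alone, while the quadratic part converges by
    continuity.\<close>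
  let ?a = "\<lambda>n. ereal ((m + inverse (real (Suc n)) - 1 / 2 * (norm (u n - v))\<^sup>2) / t)"
  have "f p \<le> ereal ((m + 0 - 1 / 2 * (norm (p - v))\<^sup>2) / t)"
  proof (rule lsc_le_limit[OF lsc p])
    show "?a \<longlonglongrightarrow> ereal ((m + 0 - 1 / 2 * (norm (p - v))\<^sup>2) / t)"
      using t by (intro tendsto_intros p LIMSEQ_inverse_real_of_nat) auto
    show "f (u n) \<le> ?a n" for n
    proof -
      have "real_of_ereal (f (u n)) \<le> (m + inverse (real (Suc n)) - 1 / 2 * (norm (u n - v))\<^sup>2) / t"
        using u(2)[of n] t unfolding \<phi>_def
        by (simp only: pos_le_divide_eq mult.commute[of _ t])
      then show ?thesis
        using ereal_real_proper[OF pr, of "u n"] u(1)[of n] unfolding D_def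
        by (metis (mono_tags, lifting) ereal_less_eq(3) mem_Collect_eq)
    qed
  qed
  then have fin: "f p \<noteq> \<infinity>" and
    "real_of_ereal (f p) \<le> (m + 0 - 1 / 2 * (norm (p - v))\<^sup>2) / t"
    using pr unfolding proper_def by (cases "f p"; auto)+
  then have "\<phi> p \<le> m"
    using t unfolding \<phi>_def by (simp add: field_simps)
  with fin m_le show thesis
    by (intro that[of p]) (auto simp: D_def \<phi>_def intro: order_trans)
qed

text \<open>Fermat's rule. Moving from \<open>p\<close> a fraction \<open>s\<close> towards
  \<open>z\<close> changes the quadratic by \<open>- s * ((v - p) \<bullet> (z - p))\<close> up to
  order \<open>s\<^sup>2\<close>, while convexity bounds the change of \<open>f\<close> by
  \<open>s\<close> times the difference of the end values. Divide by \<open>s\<close> and let it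
  tend to 0.\<close>

lemma prox_objective_minimizer_subgradient:
  fixes f :: "'a::real_inner \<Rightarrow> ereal"
  assumes conv: "econvex f" and pr: "proper f" and t: "0 < t" and fin: "f p \<noteq> \<infinity>"
    and min: "\<And>z. f z \<noteq> \<infinity> \<Longrightarrow> t * real_of_ereal (f p) + 1 / 2 * (norm (p - v))\<^sup>2
      \<le> t * real_of_ereal (f z) + 1 / 2 * (norm (z - v))\<^sup>2"
  shows "(v - p) /\<^sub>R t \<in> subdifferential f p"
proof -
  have "f p + ereal (((v - p) /\<^sub>R t) \<bullet> (z - p)) \<le> f z" for z
  proof (cases "f z = \<infinity>")
    case False
    have "t * real_of_ereal (f p) + (v - p) \<bullet> (z - p) \<le> t * real_of_ereal (f z)"
    proof (rule le_of_le_add_small)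
      fix s :: real
      assume s: "0 < s" "s < 1"
      let ?w = "(1 - s) *\<^sub>R p + s *\<^sub>R z"
      note W = econvexD_real[OF conv pr fin False s]
      have "?w - v = (p - v) + s *\<^sub>R (z - p)"
        by (simp add: algebra_simps)
      moreover have "(norm ((p - v) + s *\<^sub>R (z - p)))\<^sup>2
          = (norm (p - v))\<^sup>2 - 2 * s * ((v - p) \<bullet> (z - p)) + s\<^sup>2 * (norm (z - p))\<^sup>2"
        by (simp only: power2_norm_eq_inner inner_add_left inner_add_right inner_scaleR_left
            inner_scaleR_right inner_commute[of "z - p" "p - v"])
          (simp add: power2_eq_square inner_diff_left[of p v] inner_diff_left[of v p] algebra_simps)
      ultimately have "(norm (?w - v))\<^sup>2
          = (norm (p - v))\<^sup>2 - 2 * s * ((v - p) \<bullet> (z - p)) + s\<^sup>2 * (norm (z - p))\<^sup>2"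
        by (simp only:)
      moreover have "t * real_of_ereal (f ?w)
          \<le> t * ((1 - s) * real_of_ereal (f p) + s * real_of_ereal (f z))"
        using W(2) t by simp
      ultimately have "s * (t * real_of_ereal (f p) + (v - p) \<bullet> (z - p))
          \<le> s * (t * real_of_ereal (f z) + s * (1 / 2 * (norm (z - p))\<^sup>2))"
        using min[OF W(1)] by (simp add: power2_eq_square algebra_simps)
      then show "t * real_of_ereal (f p) + (v - p) \<bullet> (z - p)
          \<le> t * real_of_ereal (f z) + s * (1 / 2 * (norm (z - p))\<^sup>2)"
        using s by simp
    qed
    then have "t * (real_of_ereal (f p) + ((v - p) /\<^sub>R t) \<bullet> (z - p)) \<le> t * real_of_ereal (f z)"
      using t by (simp add: distrib_left flip: mult.assoc)
    then have "real_of_ereal (f p) + ((v - p) /\<^sub>R t) \<bullet> (z - p) \<le> real_of_ereal (f z)"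
      by (simp only: mult_le_cancel_left_pos[OF t])
    then show ?thesis
      using ereal_real_proper[OF pr fin] ereal_real_proper[OF pr False]
      by (metis ereal_less_eq(3) plus_ereal.simps(1))
  qed simp
  then show ?thesis
    unfolding subdifferential_def by blast
qed

text \<open>Without an affine minorant the objective of \<open>prox\<close> would need a separation argument to
  be bounded below; here any subgradient of \<open>f\<close> provides one.\<close>

lemma prox_subgradient:
  fixes f :: "'a::{real_inner, complete_space} \<Rightarrow> ereal"
  assumes conv: "econvex f" and pr: "proper f" and lsc: "lsc f" and t: "0 < t"
    and q: "q \<in> subdifferential f w"
  shows "(v - prox t f v) /\<^sub>R t \<in> subdifferential f (prox t f v)"
proof -
  let ?h = "\<lambda>x. ereal t * f x + ereal (1 / 2 * (norm (x - v))\<^sup>2)"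
  have minorant: "- (q \<bullet> w - real_of_ereal (f w)) - norm q * norm z \<le> real_of_ereal (f z)"
    if "f z \<noteq> \<infinity>" for z
    using subdifferentialD_real[OF pr q that] Cauchy_Schwarz_ineq2[of q z]
    by (simp add: inner_diff_right)
  have h: "?h z = ereal (t * real_of_ereal (f z) + 1 / 2 * (norm (z - v))\<^sup>2)"
    if "f z \<noteq> \<infinity>" for z
    using ereal_real_proper[OF pr that]
    by (metis plus_ereal.simps(1) times_ereal.simps(1))
  have h_inf: "?h z = \<infinity>" if "f z = \<infinity>" for z
    using that t by simp
  obtain p where p: "f p \<noteq> \<infinity>"
    "\<And>z. f z \<noteq> \<infinity> \<Longrightarrow> t * real_of_ereal (f p) + 1 / 2 * (norm (p - v))\<^sup>2
      \<le> t * real_of_ereal (f z) + 1 / 2 * (norm (z - v))\<^sup>2"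
    using prox_objective_minimizer_exists[OF conv pr lsc t minorant, of v] by metis
  have "?h p \<le> ?h z" for z
    using p(2)[of z] h_inf[of z] h[of z] h[OF p(1)] by (cases "f z = \<infinity>") auto
  then have "is_arg_min ?h (\<lambda>_. True) p"
    unfolding is_arg_min_linorder by simp
  \<comment> \<open>\<open>prox\<close> is defined by choice, so it is known to minimise only once
    some minimiser \<open>p\<close> has been exhibited.\<close>
  then have *: "?h (prox t f v) \<le> ?h z" for z
    using someI[of "is_arg_min ?h (\<lambda>_. True)" p] unfolding prox_def arg_min_def is_arg_min_linorder
    by simp
  then have fin: "f (prox t f v) \<noteq> \<infinity>"
    using h[OF p(1)] h_inf by (metis ereal_infty_less_eq(1) PInfty_neq_ereal(1))
  show ?thesis
  proof (rule prox_objective_minimizer_subgradient[OF conv pr t fin])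
    fix z assume "f z \<noteq> \<infinity>"
    then show "t * real_of_ereal (f (prox t f v)) + 1 / 2 * (norm (prox t f v - v))\<^sup>2
      \<le> t * real_of_ereal (f z) + 1 / 2 * (norm (z - v))\<^sup>2"
      using *[of z] h[OF fin] h[of z] by (metis ereal_less_eq(3))
  qed
qed

text \<open>The representing vector is the minimiser of \<open>1/2 \<parallel>z\<parallel>\<^sup>2 - l z\<close>.\<close>

lemma riesz_representation:
  fixes l :: "'a::{real_inner, complete_space} \<Rightarrow> real"
  assumes "bounded_linear l"
  obtains r where "\<And>x. l x = r \<bullet> x"
proof -
  interpret bounded_linear l by fact
  let ?f = "\<lambda>z. ereal (- l z)"
  have 1: "econvex ?f"
    unfolding econvex_def by (simp add: add scaleR)
  have 2: "proper ?f"
    unfolding proper_def by simp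
  have 3: "lsc ?f"
    unfolding lsc_def
  proof
    fix x
    have "((\<lambda>z. ereal (- l z)) \<longlongrightarrow> ereal (- l x)) (at x)"
      by (intro tendsto_intros tendsto)
    then show "?f x \<le> Liminf (at x) ?f"
      \<comment> \<open>In the zero space \<open>at x\<close> is the bottom filter, on which
        \<open>Liminf\<close> is the top element; otherwise \<open>Liminf\<close> is the
        limit.\<close>
      by (cases "at x = bot") (simp_all only: lim_imp_Liminf Liminf_bot top_greatest order_refl not_False_eq_True)
  qed
  have 4: "- 0 - onorm l * norm z \<le> real_of_ereal (?f z)" for z
    using onorm[OF assms, of z] by simp
  obtain p where p: "\<And>z. 1 * real_of_ereal (?f p) + 1 / 2 * (norm (p - 0))\<^sup>2
      \<le> 1 * real_of_ereal (?f z) + 1 / 2 * (norm (z - 0))\<^sup>2"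
    using prox_objective_minimizer_exists[OF 1 2 3 zero_less_one 4, of 0] by (metis PInfty_neq_ereal(1))
  then have "(0 - p) /\<^sub>R 1 \<in> subdifferential ?f p"
    by (intro prox_objective_minimizer_subgradient[OF 1 2]) auto
  then have le: "- l p - p \<bullet> (z - p) \<le> - l z" for z
    unfolding subdifferential_def by (simp add: algebra_simps)
  have "l x = p \<bullet> x" for x
    \<comment> \<open>The points \<open>p + x\<close> and \<open>p - x\<close> give the two opposite
      inequalities by linearity of \<open>l\<close>.\<close>
    using le[of "p + x"] le[of "p - x"] by (simp add: add diff)
  then show thesis by (rule that)
qed

text \<open>\<open>adjoint\<close> is a choice operator, so its equation holds as soon as one
  suitable map exists; representing the functional \<open>\<lambda>u. K u \<bullet> w\<close> for
  each \<open>w\<close> supplies one.\<close>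

lemma adjoint_bounded_linear:
  fixes K :: "'a::{real_inner, complete_space} \<Rightarrow> 'b::real_inner"
  assumes "bounded_linear K"
  shows "K u \<bullet> w = u \<bullet> adjoint K w"
proof -
  have "\<exists>r. \<forall>u. K u \<bullet> w = u \<bullet> r" for w
    using riesz_representation[OF bounded_linear_inner_left_comp[OF assms, of w]]
    by (metis inner_commute)
  then have "\<exists>A. \<forall>u w. K u \<bullet> w = u \<bullet> A w" by metis
  then show ?thesis
    unfolding adjoint_def
    using someI_ex[of "\<lambda>A. \<forall>u w. K u \<bullet> w = u \<bullet> A w"] by blast
qed

section \<open>A single inertial, corrected proximal step\<close>

text \<open>The Bregman distance, with slope \<open>q\<close> at \<open>p\<close>, of
  \<open>f\<close> minus \<open>\<gamma> / 2\<close> times the squared distance to \<open>p\<close>.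
  Centring the quadratic at \<open>p\<close> leaves the slope there unchanged.\<close>

definition reduced_bregman :: "real \<Rightarrow> ('a::real_inner \<Rightarrow> ereal) \<Rightarrow> 'a \<Rightarrow> 'a \<Rightarrow> 'a \<Rightarrow> real" where
  "reduced_bregman \<gamma> f q p z = real_of_ereal (f z) - real_of_ereal (f p) - q \<bullet> (z - p)
     - \<gamma> / 2 * (norm (z - p))\<^sup>2"

lemma reduced_bregman_nonneg:
  assumes "strongly_econvex \<gamma> f" "proper f" "q \<in> subdifferential f p" "f z \<noteq> \<infinity>"
  shows "0 \<le> reduced_bregman \<gamma> f q p z"
  using strong_subgradient_inequality[OF assms] unfolding reduced_bregman_def by linarith

lemma reduced_bregman_self [simp]: "reduced_bregman \<gamma> f q p p = 0"
  by (simp add: reduced_bregman_def)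

text \<open>Expanding the quadratic around \<open>x\<close> leaves
  \<open>\<gamma> / 2 * (norm (z - x))\<^sup>2\<close> to be subtracted, which is exactly what
  strong convexity of \<open>f\<close> at \<open>x\<close> pays for.\<close>

lemma reduced_bregman_subgradient:
  assumes "strongly_econvex \<gamma> f" "proper f" "r \<in> subdifferential f x" "f z \<noteq> \<infinity>"
  shows "reduced_bregman \<gamma> f q p x + (r - q - \<gamma> *\<^sub>R (x - p)) \<bullet> (z - x)
    \<le> reduced_bregman \<gamma> f q p z"
proof -
  have "z - p = (x - p) + (z - x)" by simp
  then have "(norm (z - p))\<^sup>2 = (norm (x - p))\<^sup>2 + (norm (z - x))\<^sup>2 + 2 * ((x - p) \<bullet> (z - x))"
    by (simp only: power2_norm_eq_inner inner_add_left inner_add_right inner_commute[of "z - x" "x - p"])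
  then have "\<gamma> / 2 * (norm (z - p))\<^sup>2 = \<gamma> / 2 * (norm (x - p))\<^sup>2
      + \<gamma> / 2 * (norm (z - x))\<^sup>2 + \<gamma> * ((x - p) \<bullet> (z - x))"
    by (simp add: distrib_left add_divide_distrib)
  moreover have "q \<bullet> (z - p) = q \<bullet> (z - x) + q \<bullet> (x - p)"
    by (simp add: inner_diff_right)
  ultimately show ?thesis
    using strong_subgradient_inequality[OF assms] unfolding reduced_bregman_def
    by (simp add: inner_diff_left[of "r - q"] inner_diff_left[of r q] add_divide_distrib)
qed

text \<open>Testing the subgradient at \<open>x'\<close> against \<open>\<lambda> p + (1 - \<lambda>) x\<close> produces the auxiliary point
  \<open>\<zeta>'\<close>, because \<open>x' - \<lambda> p - (1 - \<lambda>) x = \<lambda> (\<zeta>' - p)\<close>. For \<open>\<lambda> = 1\<close> the value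
  \<open>f x\<close> is irrelevant, so that the first iterate need not lie in the domain of \<open>f\<close>.\<close>

lemma inertial_prox_step:
  fixes f :: "'a::{real_inner, complete_space} \<Rightarrow> ereal"
  assumes f: "econvex f" "proper f" "lsc f" "strongly_econvex \<gamma> f"
    and pos: "0 \<le> \<gamma>" "0 < \<tau>" "0 < l" "l \<le> 1"
    and q: "q \<in> subdifferential f p"
    and x': "x' = prox (corrected_step \<gamma> \<tau> l) f
      (corrected_base \<gamma> \<tau> l xb x + corrected_step \<gamma> \<tau> l *\<^sub>R w)"
    and xb: "xb = (1 - l) *\<^sub>R x + l *\<^sub>R \<zeta>"
    and \<zeta>': "\<zeta>' = inverse l *\<^sub>R x' - (inverse l - 1) *\<^sub>R x"
    and fin: "f x \<noteq> \<infinity> \<or> l = 1"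
  shows "f x' \<noteq> \<infinity>"
    and "reduced_bregman \<gamma> f q p x' - (1 - l) * reduced_bregman \<gamma> f q p x
      \<le> - (l\<^sup>2 / \<tau>) * ((\<zeta>' - \<zeta>) \<bullet> (\<zeta>' - p)) - l * \<gamma> * (norm (\<zeta>' - p))\<^sup>2
        + l * ((w - q) \<bullet> (\<zeta>' - p))"
proof -
  define d where "d = 1 + \<gamma> * \<tau> * (inverse l - 1)"
  have "1 \<le> inverse l"
    using pos by (simp add: one_le_inverse)
  then have d: "0 < d"
    unfolding d_def using pos by (simp add: add_pos_nonneg)
  let ?t = "corrected_step \<gamma> \<tau> l"
  let ?v = "corrected_base \<gamma> \<tau> l xb x + ?t *\<^sub>R w"
  have t: "?t = \<tau> / d"
    unfolding corrected_step_def d_def ..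
  have v: "?v = (xb + (d - 1) *\<^sub>R x) /\<^sub>R d + (\<tau> / d) *\<^sub>R w"
    unfolding corrected_base_def corrected_step_def d_def by simp
  define r where "r = (?v - x') /\<^sub>R ?t"
  have "0 < ?t"
    using pos d t by simp
  from prox_subgradient[OF f(1-3) this q, of ?v]
  have r: "r \<in> subdifferential f x'"
    unfolding r_def x' .
  then show fin': "f x' \<noteq> \<infinity>"
    by (rule subdifferential_finite[OF f(2)])
  have x'_eq: "x' = l *\<^sub>R \<zeta>' + (1 - l) *\<^sub>R x"
    unfolding \<zeta>' using pos by (simp add: algebra_simps)
  have "\<tau> *\<^sub>R r = d *\<^sub>R (?v - x')"
    unfolding r_def t using pos d by (simp add: divide_simps)
  also have "\<dots> = xb + (d - 1) *\<^sub>R x + \<tau> *\<^sub>R w - d *\<^sub>R x'"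
    unfolding v using d by (simp add: scaleR_add_right scaleR_diff_right)
  also have "\<dots> = \<tau> *\<^sub>R w - l *\<^sub>R (\<zeta>' - \<zeta>) - (d - 1) *\<^sub>R (x' - x)"
    unfolding xb x'_eq by (simp add: algebra_simps)
  \<comment> \<open>This is the effect of the correction: combined with
    \<open>\<gamma> *\<^sub>R (x' - p)\<close> it moves the strong convexity term from
    \<open>x'\<close> to the auxiliary point \<open>\<zeta>'\<close>.\<close>
  also have "(d - 1) *\<^sub>R (x' - x) = \<tau> *\<^sub>R \<gamma> *\<^sub>R (\<zeta>' - x')"
    unfolding d_def \<zeta>' by (simp add: algebra_simps)
  finally have "\<tau> *\<^sub>R (r - q - \<gamma> *\<^sub>R (x' - p)) =
      \<tau> *\<^sub>R (w - q - \<gamma> *\<^sub>R (\<zeta>' - p)) - l *\<^sub>R (\<zeta>' - \<zeta>)"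
    by (simp add: algebra_simps)
  then have "inverse \<tau> *\<^sub>R \<tau> *\<^sub>R (r - q - \<gamma> *\<^sub>R (x' - p)) =
      inverse \<tau> *\<^sub>R (\<tau> *\<^sub>R (w - q - \<gamma> *\<^sub>R (\<zeta>' - p)) - l *\<^sub>R (\<zeta>' - \<zeta>))"
    by simp
  then have grad: "r - q - \<gamma> *\<^sub>R (x' - p) = w - q - \<gamma> *\<^sub>R (\<zeta>' - p) - (l / \<tau>) *\<^sub>R (\<zeta>' - \<zeta>)"
    using pos by (simp add: scaleR_diff_right[of "inverse \<tau>"] divide_inverse_commute)
  let ?B = "reduced_bregman \<gamma> f q p" and ?g = "r - q - \<gamma> *\<^sub>R (x' - p)"
  have "l * (?B x' + ?g \<bullet> (p - x')) \<le> l * ?B p"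
    using reduced_bregman_subgradient[OF f(4,2) r subdifferential_finite[OF f(2) q], of q p] pos
    by (intro mult_left_mono) auto
  moreover have "(1 - l) * (?B x' + ?g \<bullet> (x - x')) \<le> (1 - l) * ?B x"
    using reduced_bregman_subgradient[OF f(4,2) r, of x q p] pos fin
    by (cases "l = 1") (auto intro!: mult_left_mono)
  ultimately have "?B x' + ?g \<bullet> (l *\<^sub>R (p - x') + (1 - l) *\<^sub>R (x - x')) \<le> (1 - l) * ?B x"
    by (simp add: inner_add_right algebra_simps)
  also have "l *\<^sub>R (p - x') + (1 - l) *\<^sub>R (x - x') = - (l *\<^sub>R (\<zeta>' - p))"
    unfolding x'_eq by (simp add: algebra_simps)
  finally have "?B x' - (1 - l) * ?B x \<le> l * (?g \<bullet> (\<zeta>' - p))"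
    by simp
  also have "\<dots> = - (l\<^sup>2 / \<tau>) * ((\<zeta>' - \<zeta>) \<bullet> (\<zeta>' - p)) - l * \<gamma> * (norm (\<zeta>' - p))\<^sup>2
        + l * ((w - q) \<bullet> (\<zeta>' - p))"
    unfolding grad power2_norm_eq_inner
    by (simp add: inner_diff_left power2_eq_square algebra_simps)
  finally show "?B x' - (1 - l) * ?B x \<le> - (l\<^sup>2 / \<tau>) * ((\<zeta>' - \<zeta>) \<bullet> (\<zeta>' - p))
      - l * \<gamma> * (norm (\<zeta>' - p))\<^sup>2 + l * ((w - q) \<bullet> (\<zeta>' - p))" .
qed

text \<open>Cauchy-Schwarz, then Young's inequality for the norms scaled by
  \<open>1 / sqrt t\<close> and \<open>1 / sqrt s\<close>. With the initial step lengths as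
  \<open>t\<close> and \<open>s\<close>, the prefactor is the square root of the quantity in the
  step length condition.\<close>

lemma coupling_bound:
  fixes K :: "'a::real_inner \<Rightarrow> 'b::real_inner"
  assumes "bounded_linear K" "0 < t" "0 < s"
  shows "a * (K u \<bullet> w) \<le> sqrt (t * s) * onorm K
    * (a\<^sup>2 / (2 * t) * (norm u)\<^sup>2 + (norm w)\<^sup>2 / (2 * s))"
proof -
  define p where "p = \<bar>a\<bar> * norm u / sqrt t"
  define q where "q = norm w / sqrt s"
  have "a * (K u \<bullet> w) \<le> \<bar>a\<bar> * \<bar>K u \<bullet> w\<bar>"
    by (simp flip: abs_mult)
  also have "\<dots> \<le> \<bar>a\<bar> * ((onorm K * norm u) * norm w)"
    using order_trans[OF Cauchy_Schwarz_ineq2 mult_right_mono[OF onorm[OF assms(1)] norm_ge_zero]]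
    by (intro mult_left_mono) auto
  also have "\<dots> = sqrt (t * s) * onorm K * (p * q)"
    unfolding p_def q_def using assms by (simp add: real_sqrt_mult)
  also have "\<dots> \<le> sqrt (t * s) * onorm K * (p\<^sup>2 / 2 + q\<^sup>2 / 2)"
    using assms onorm_pos_le[OF assms(1)] sum_squares_bound[of p q]
    by (intro mult_left_mono) auto
  also have "p\<^sup>2 / 2 + q\<^sup>2 / 2 = a\<^sup>2 / (2 * t) * (norm u)\<^sup>2 + (norm w)\<^sup>2 / (2 * s)"
    unfolding p_def q_def using assms by (simp add: power_divide power_mult_distrib)
  finally show ?thesis .
qed

section \<open>Step length and inertial parameters\<close>

text \<open>Only the scalar recursions are fixed here, so the energy estimates below apply to any
  sequences that satisfy the primal and dual inequalities.\<close>

locale accelerated_steps =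
  fixes \<gamma> \<epsilon> :: real and \<tau> \<sigma> lam \<omega> :: "nat \<Rightarrow> real"
  assumes gamma_pos: "0 < \<gamma>"
    and eps: "0 \<le> \<epsilon>" "\<epsilon> < 1"
    and init: "0 < \<tau> 0" "0 < \<sigma> 0" "lam 0 = 1"
    and tau_update: "\<And>i. \<tau> (Suc i) = \<tau> i * inverse (lam i) * lam (Suc i) * \<omega> i"
    and omega_def: "\<And>i. \<omega> i = (inverse (lam (Suc i)) - 1) / (inverse (lam i) - \<epsilon>)"
    and sigma_update: "\<And>i. \<sigma> (Suc i) = \<sigma> i * inverse (lam i) * lam (Suc i) / \<omega> i"
    and lam_update: "\<And>i. lam (Suc i) =
          sqrt ((lam i)\<^sup>2 + 2 * \<gamma> * lam i * \<tau> i)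
          / (1 - \<epsilon> * lam i + sqrt ((lam i)\<^sup>2 + 2 * \<gamma> * lam i * \<tau> i))"
begin

primrec weight :: "nat \<Rightarrow> real" where
  "weight 0 = 1"
| "weight (Suc i) = weight i / \<omega> i"

text \<open>The multiplier \<open>\<phi>\<close> of the overview: iteration \<open>i\<close>
  multiplies the primal inequality by \<open>gap_weight i\<close> and the dual one by
  \<open>gap_weight (Suc i)\<close>, as the dual parameters run one index ahead.\<close>

definition gap_weight :: "nat \<Rightarrow> real" where
  "gap_weight i = weight i / lam i"

text \<open>Numerator and denominator of \<open>\<omega> i\<close> share the factor
  \<open>1 - \<epsilon> * lam i\<close>, positive because \<open>\<epsilon> < 1\<close>, so
  \<open>\<epsilon>\<close> cancels from the quotient.\<close>

lemma parameter_step: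
  assumes "0 < lam i" "lam i \<le> 1" "0 < \<tau> i"
  shows "0 < lam (Suc i)" "lam (Suc i) \<le> 1" "\<omega> i > 0"
    and "\<omega> i = lam i / sqrt ((lam i)\<^sup>2 + 2 * \<gamma> * lam i * \<tau> i)"
proof -
  define s where "s = sqrt ((lam i)\<^sup>2 + 2 * \<gamma> * lam i * \<tau> i)"
  have s: "0 < s"
    unfolding s_def using assms gamma_pos by (simp add: add_pos_pos)
  have "\<epsilon> * lam i \<le> \<epsilon>"
    using assms eps by (simp add: mult_left_le)
  then have d: "0 < 1 - \<epsilon> * lam i"
    using eps by linarith
  have l: "lam (Suc i) = s / (1 - \<epsilon> * lam i + s)"
    unfolding lam_update s_def ..
  show "0 < lam (Suc i)" "lam (Suc i) \<le> 1"
    unfolding l using s d by (auto simp: divide_simps)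
  have "inverse (lam (Suc i)) - 1 = (1 - \<epsilon> * lam i) / s"
    unfolding l using s d by (simp add: field_simps)
  moreover have "inverse (lam i) - \<epsilon> = (1 - \<epsilon> * lam i) / lam i"
    using assms by (simp add: field_simps)
  ultimately have "\<omega> i = lam i / s"
    unfolding omega_def using d s assms by simp
  then show "\<omega> i = lam i / sqrt ((lam i)\<^sup>2 + 2 * \<gamma> * lam i * \<tau> i)" "\<omega> i > 0"
    using s assms unfolding s_def by auto
qed

lemma lam_tau_bounds: "0 < lam i \<and> lam i \<le> 1 \<and> 0 < \<tau> i"
proof (induction i)
  case 0
  then show ?case using init by simp
next
  case (Suc i)
  then show ?case using parameter_step(1-3)[of i]
    unfolding tau_update by simp
qed

lemma lam_pos: "0 < lam i" and lam_le_one: "lam i \<le> 1" and tau_pos: "0 < \<tau> i"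
  using lam_tau_bounds by auto

lemma omega_pos: "0 < \<omega> i"
  by (rule parameter_step(3)[OF lam_pos lam_le_one tau_pos])

lemma weight_pos: "0 < weight i"
  by (induction i) (auto simp: omega_pos)

lemma sigma_eq: "\<sigma> i = \<sigma> 0 * weight i * lam i"
  using init lam_pos[THEN less_imp_neq] omega_pos[THEN less_imp_neq]
  by (induction i) (auto simp: sigma_update field_simps)

lemma sigma_pos: "0 < \<sigma> i"
  unfolding sigma_eq[of i] using init weight_pos lam_pos by simp

lemma tau_eq: "\<tau> i * weight i = \<tau> 0 * lam i"
proof (induction i)
  case 0
  then show ?case using init by simp
next
  case (Suc i)
  have "\<tau> (Suc i) * weight (Suc i) = (\<tau> i * weight i) * lam (Suc i) / lam i"
    using omega_pos[of i] unfolding tau_update by (simp add: field_simps)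
  then show ?case
    unfolding Suc using lam_pos[of i] by simp
qed

text \<open>Squaring the closed form of \<open>\<omega> i\<close> gives the growth factor
  \<open>1 + 2 * \<gamma> * \<tau> i / lam i\<close>, and \<open>tau_eq\<close> trades
  \<open>\<tau> i\<close> for \<open>\<tau> 0\<close>.\<close>

lemma weight_Suc_sq: "(weight (Suc i))\<^sup>2 = (weight i)\<^sup>2 + 2 * \<gamma> * \<tau> 0 * weight i"
proof -
  let ?r = "(lam i)\<^sup>2 + 2 * \<gamma> * lam i * \<tau> i"
  have "0 < ?r"
    using lam_pos[of i] tau_pos[of i] gamma_pos by (simp add: add_pos_pos)
  then have "(weight (Suc i))\<^sup>2 = (weight i)\<^sup>2 * ?r / (lam i)\<^sup>2"
    using parameter_step(4)[OF lam_pos lam_le_one tau_pos, of i]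
    by (simp add: power_divide power_mult_distrib)
  also have "\<dots> = (weight i)\<^sup>2 + 2 * \<gamma> * (\<tau> i * weight i) * weight i / lam i"
    using lam_pos[of i] by (simp add: field_simps power2_eq_square)
  also have "\<dots> = (weight i)\<^sup>2 + 2 * \<gamma> * \<tau> 0 * weight i"
    unfolding tau_eq using lam_pos[of i] by simp
  finally show ?thesis .
qed

lemma gap_weight_Suc: "gap_weight (Suc i) * (1 - lam (Suc i)) = gap_weight i - \<epsilon> * weight i"
proof -
  have "gap_weight (Suc i) * (1 - lam (Suc i)) = weight (Suc i) * (inverse (lam (Suc i)) - 1)"
    unfolding gap_weight_def using lam_pos[of "Suc i"] by (simp add: field_simps)
  \<comment> \<open>Were the divisor of \<open>\<omega> i\<close> zero, \<open>\<omega> i\<close>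
    would itself be 0 by convention, against its positivity.\<close>
  also have "inverse (lam (Suc i)) - 1 = \<omega> i * (inverse (lam i) - \<epsilon>)"
    using omega_pos[of i] unfolding omega_def by (cases "inverse (lam i) = \<epsilon>") auto
  also have "weight (Suc i) * \<dots> = gap_weight i - \<epsilon> * weight i"
    unfolding gap_weight_def using omega_pos[of i] by (simp add: field_simps)
  finally show ?thesis .
qed

lemma gap_weight_Suc_le: "gap_weight (Suc i) * (1 - lam (Suc i)) \<le> gap_weight i"
  unfolding gap_weight_Suc using eps weight_pos[of i] by simp

lemma gap_weight_pos: "0 < gap_weight i"
  unfolding gap_weight_def using lam_pos weight_pos by simp

lemma gap_weight_increment: "gap_weight (Suc i) = gap_weight i + weight (Suc i) - \<epsilon> * weight i"
proof -
  have "gap_weight (Suc i) * lam (Suc i) = weight (Suc i)"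
    unfolding gap_weight_def using lam_pos[of "Suc i"] by simp
  then show ?thesis
    using gap_weight_Suc[of i] by (simp add: algebra_simps)
qed

section \<open>Growth of the weights\<close>

text \<open>Writing \<open>b\<close> for \<open>weight i\<close>, the bounds
  \<open>c \<le> 1 \<le> b\<close> and \<open>3 * c \<le> 2 * k\<close> give \<open>(b + c)\<^sup>2
  \<le> b\<^sup>2 + 3 * c * b \<le> b\<^sup>2 + 2 * k * b\<close>, the square of the next weight.
  The choice \<open>k / (2 + k)\<close> meets both bounds on \<open>c\<close> for every positive
  \<open>k\<close>.\<close>

lemma weight_growth:
  obtains c where "0 < c" "c \<le> 1" "\<And>i. 1 + c * real i \<le> weight i"
proof -
  define k where "k = \<gamma> * \<tau> 0"
  define c where "c = k / (2 + k)"
  have k: "0 < k"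
    unfolding k_def using gamma_pos init by simp
  have c: "0 < c" "c \<le> 1" "3 * c \<le> 2 * k"
    unfolding c_def using k by (auto simp: field_simps)
  have "1 + c * real i \<le> weight i" for i
  proof (induction i)
    case (Suc i)
    then have w: "1 \<le> weight i"
      using c by (smt (verit) mult_nonneg_nonneg of_nat_0_le_iff)
    have "c * c \<le> c * weight i"
      using c w by (intro mult_left_mono) auto
    moreover have "3 * c * weight i \<le> 2 * k * weight i"
      using c w by (intro mult_right_mono) auto
    ultimately have "(weight i + c)\<^sup>2 \<le> (weight (Suc i))\<^sup>2"
      unfolding weight_Suc_sq k_def by (simp add: power2_eq_square algebra_simps)
    then have "weight i + c \<le> weight (Suc i)"
      by (rule power2_le_imp_le[OF _ weight_pos[THEN less_imp_le]])
    then show ?case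
      using Suc by (simp add: algebra_simps)
  qed simp
  with c show thesis by (intro that)
qed

lemma weight_le_Suc: "weight i \<le> weight (Suc i)"
proof -
  have "(weight i)\<^sup>2 \<le> (weight (Suc i))\<^sup>2"
    unfolding weight_Suc_sq using gamma_pos init weight_pos[of i] by simp
  then show ?thesis
    by (rule power2_le_imp_le[OF _ weight_pos[THEN less_imp_le]])
qed

lemma gap_weight_le_Suc: "gap_weight i + (1 - \<epsilon>) * weight i \<le> gap_weight (Suc i)"
  using weight_le_Suc[of i] unfolding gap_weight_increment by (simp add: algebra_simps)

text \<open>Each increment is at least \<open>(1 - \<epsilon>) * weight i\<close>, hence grows
  linearly since \<open>\<epsilon> < 1\<close>; the sum grows quadratically.\<close>

lemma gap_weight_growth:
  obtains C where "0 < C" "\<And>i. C * (real (Suc i))\<^sup>2 \<le> gap_weight i"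
proof -
  obtain c where c: "0 < c" "c \<le> 1" "\<And>i. 1 + c * real i \<le> weight i"
    using weight_growth by blast
  define C where "C = (1 - \<epsilon>) * c / 4"
  have C: "0 < C"
    unfolding C_def using c eps by simp
  have "C * (real (Suc i))\<^sup>2 \<le> gap_weight i" for i
  proof (induction i)
    case 0
    have "(1 - \<epsilon>) * c \<le> 1"
      using c eps by (intro mult_le_one) auto
    then show ?case
      unfolding gap_weight_def C_def using init by simp
  next
    case (Suc i)
    \<comment> \<open>\<open>2 * i + 3\<close> is the difference of the squares of
      \<open>i + 2\<close> and \<open>i + 1\<close>.\<close>
    have "C * (2 * real i + 3) = (1 - \<epsilon>) * (c / 2 * real i + 3 / 4 * c)"
      unfolding C_def by (simp add: field_simps)
    also have "c / 2 * real i + 3 / 4 * c \<le> 1 + c * real i"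
      using c(1,2) mult_nonneg_nonneg[OF less_imp_le[OF c(1)], of "real i"] by linarith
    then have "(1 - \<epsilon>) * (c / 2 * real i + 3 / 4 * c) \<le> (1 - \<epsilon>) * (1 + c * real i)"
      using eps by (intro mult_left_mono) auto
    also have "\<dots> \<le> (1 - \<epsilon>) * weight i"
      using c(3)[of i] eps by (intro mult_left_mono) auto
    finally have "C * (2 * real i + 3) + C * (real (Suc i))\<^sup>2 \<le> gap_weight (Suc i)"
      using Suc gap_weight_le_Suc[of i] by linarith
    then show ?case
      by (simp add: power2_eq_square algebra_simps)
  qed
  with C show thesis by (rule that)
qed

section \<open>Energy estimates\<close>

text \<open>In the weighted sum the couplings combine to \<open>weight (Suc i) * (K X' \<bullet> Y')
  - weight i * (K X \<bullet> Y)\<close>, which telescopes, plus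
  \<open>weight i * (K (X' - X) \<bullet> (Y' - Y))\<close>. The squared increments left over by the
  polarisation identity \<open>half\<close> absorb this remainder.\<close>

lemma energy_step:
  fixes K :: "'a::real_inner \<Rightarrow> 'b::real_inner"
  assumes K: "bounded_linear K" "\<tau> 0 * \<sigma> 0 * (onorm K)\<^sup>2 \<le> 1"
    and primal: "g' - (1 - lam i) * g \<le> - ((lam i)\<^sup>2 / \<tau> i) * ((X' - X) \<bullet> X')
      - lam i * \<gamma> * (norm X')\<^sup>2 - lam i * (K X' \<bullet> Y)"
    and dual: "f' - (1 - lam (Suc i)) * f
      \<le> - ((lam (Suc i))\<^sup>2 / \<sigma> (Suc i)) * ((Y' - Y) \<bullet> Y')
        + lam (Suc i) * (K (X' + \<omega> i *\<^sub>R (X' - X)) \<bullet> Y')"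
  shows "gap_weight i * g' + gap_weight (Suc i) * f'
      + (weight (Suc i))\<^sup>2 / (2 * \<tau> 0) * (norm X')\<^sup>2 + (norm Y')\<^sup>2 / (2 * \<sigma> 0)
      - weight (Suc i) * (K X' \<bullet> Y')
    \<le> gap_weight i * (1 - lam i) * g + gap_weight (Suc i) * (1 - lam (Suc i)) * f
      + (weight i)\<^sup>2 / (2 * \<tau> 0) * (norm X)\<^sup>2 + (norm Y)\<^sup>2 / (2 * \<sigma> 0)
      - weight i * (K X \<bullet> Y)"
proof -
  let ?a = "weight i" and ?b = "weight (Suc i)"
  have kappa: "sqrt (\<tau> 0 * \<sigma> 0) * onorm K \<le> 1"
    by (rule power2_le_imp_le) (use K(2) init in \<open>simp_all add: power_mult_distrib\<close>)
  interpret K: bounded_linear K by fact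
  have half: "(u' - u) \<bullet> u' = (norm u')\<^sup>2 / 2 - (norm u)\<^sup>2 / 2 + (norm (u' - u))\<^sup>2 / 2"
    for u u' :: "'c::real_inner"
    by (simp add: power2_norm_eq_inner inner_simps inner_commute field_simps)
  have \<phi>l: "gap_weight j * lam j = weight j" for j
    unfolding gap_weight_def using lam_pos[of j] by simp
  have P: "gap_weight i * ((lam i)\<^sup>2 / \<tau> i) = ?a\<^sup>2 / \<tau> 0"
  proof -
    have "gap_weight i * ((lam i)\<^sup>2 / \<tau> i) = ?a * lam i / \<tau> i"
      unfolding \<phi>l[symmetric] by (simp add: power2_eq_square)
    also have "\<dots> = ?a\<^sup>2 / \<tau> 0"
      using tau_eq[of i] tau_pos[of i] init by (simp add: field_simps power2_eq_square)
    finally show ?thesis .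
  qed
  have Q: "gap_weight (Suc i) * ((lam (Suc i))\<^sup>2 / \<sigma> (Suc i)) = 1 / \<sigma> 0"
    unfolding gap_weight_def sigma_eq[of "Suc i"]
    using lam_pos[of "Suc i"] weight_pos[of "Suc i"] init
    by (simp add: power2_eq_square del: weight.simps)
  \<comment> \<open>The extrapolation in the dual step thus carries weight \<open>?a\<close>, the
    same as the primal coupling, which lets the two be merged.\<close>
  have a: "?b * \<omega> i = ?a"
    using omega_pos[of i] by simp
  have "gap_weight i * (g' - (1 - lam i) * g)
    \<le> gap_weight i * (- ((lam i)\<^sup>2 / \<tau> i) * ((X' - X) \<bullet> X')
      - lam i * \<gamma> * (norm X')\<^sup>2 - lam i * (K X' \<bullet> Y))"
    using primal gap_weight_pos[of i] by (intro mult_left_mono) auto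
  also have "\<dots> = - (gap_weight i * ((lam i)\<^sup>2 / \<tau> i)) * ((X' - X) \<bullet> X')
      - (gap_weight i * lam i) * \<gamma> * (norm X')\<^sup>2 - (gap_weight i * lam i) * (K X' \<bullet> Y)"
    by (simp only: right_diff_distrib mult_minus_left mult_minus_right mult.assoc)
  also have "\<dots> = - (?a\<^sup>2 / \<tau> 0) * ((norm X')\<^sup>2 / 2 - (norm X)\<^sup>2 / 2 + (norm (X' - X))\<^sup>2 / 2)
      - ?a * \<gamma> * (norm X')\<^sup>2 - ?a * (K X' \<bullet> Y)"
    unfolding P \<phi>l half ..
  also have "\<dots> = - (?a\<^sup>2 / (2 * \<tau> 0) + ?a * \<gamma>) * (norm X')\<^sup>2 + ?a\<^sup>2 / (2 * \<tau> 0) * (norm X)\<^sup>2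
      - ?a\<^sup>2 / (2 * \<tau> 0) * (norm (X' - X))\<^sup>2 - ?a * (K X' \<bullet> Y)"
    by (simp add: algebra_simps)
  \<comment> \<open>Here acceleration enters: strong convexity raises the weight of the new distance
    from \<open>?a\<^sup>2\<close> to \<open>?b\<^sup>2\<close>.\<close>
  also have "?a\<^sup>2 / (2 * \<tau> 0) + ?a * \<gamma> = ?b\<^sup>2 / (2 * \<tau> 0)"
    unfolding weight_Suc_sq using init by (simp add: field_simps)
  finally have 1: "gap_weight i * g' - gap_weight i * (1 - lam i) * g
    \<le> - (?b\<^sup>2 / (2 * \<tau> 0)) * (norm X')\<^sup>2 + ?a\<^sup>2 / (2 * \<tau> 0) * (norm X)\<^sup>2
      - ?a\<^sup>2 / (2 * \<tau> 0) * (norm (X' - X))\<^sup>2 - ?a * (K X' \<bullet> Y)"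
    by (simp only: right_diff_distrib[of _ g'] mult.assoc)
  have "gap_weight (Suc i) * (f' - (1 - lam (Suc i)) * f)
    \<le> gap_weight (Suc i) * (- ((lam (Suc i))\<^sup>2 / \<sigma> (Suc i)) * ((Y' - Y) \<bullet> Y')
        + lam (Suc i) * (K (X' + \<omega> i *\<^sub>R (X' - X)) \<bullet> Y'))"
    using dual gap_weight_pos[of "Suc i"] by (intro mult_left_mono) auto
  also have "\<dots> = - (gap_weight (Suc i) * ((lam (Suc i))\<^sup>2 / \<sigma> (Suc i))) * ((Y' - Y) \<bullet> Y')
      + (gap_weight (Suc i) * lam (Suc i)) * (K X' \<bullet> Y' + \<omega> i * (K (X' - X) \<bullet> Y'))"
    by (simp only: distrib_left mult_minus_left mult_minus_right mult.assoc K.add K.scaleR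
        inner_add_left inner_scaleR_left)
  also have "\<dots> = - (1 / \<sigma> 0) * ((norm Y')\<^sup>2 / 2 - (norm Y)\<^sup>2 / 2 + (norm (Y' - Y))\<^sup>2 / 2)
      + ?b * (K X' \<bullet> Y') + ?a * (K (X' - X) \<bullet> Y')"
    unfolding Q \<phi>l half by (simp only: distrib_left mult.assoc[symmetric] a add.assoc)
  finally have 2: "gap_weight (Suc i) * f' - gap_weight (Suc i) * (1 - lam (Suc i)) * f
    \<le> - ((norm Y')\<^sup>2 / (2 * \<sigma> 0)) + (norm Y)\<^sup>2 / (2 * \<sigma> 0) - (norm (Y' - Y))\<^sup>2 / (2 * \<sigma> 0)
      + ?b * (K X' \<bullet> Y') + ?a * (K (X' - X) \<bullet> Y')"
    by (simp add: algebra_simps del: weight.simps)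
  have "?a * (K (X' - X) \<bullet> (Y' - Y)) \<le> sqrt (\<tau> 0 * \<sigma> 0) * onorm K
    * (?a\<^sup>2 / (2 * \<tau> 0) * (norm (X' - X))\<^sup>2 + (norm (Y' - Y))\<^sup>2 / (2 * \<sigma> 0))"
    by (rule coupling_bound[OF K(1) init(1,2)])
  also have "\<dots> \<le> 1 * (?a\<^sup>2 / (2 * \<tau> 0) * (norm (X' - X))\<^sup>2 + (norm (Y' - Y))\<^sup>2 / (2 * \<sigma> 0))"
    using kappa init by (intro mult_right_mono) auto
  finally have 3: "?a * (K (X' - X) \<bullet> Y') - ?a * (K X' \<bullet> Y) + ?a * (K X \<bullet> Y)
    \<le> ?a\<^sup>2 / (2 * \<tau> 0) * (norm (X' - X))\<^sup>2 + (norm (Y' - Y))\<^sup>2 / (2 * \<sigma> 0)"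
    by (simp add: K.diff inner_diff_left inner_diff_right algebra_simps del: weight.simps)
  from 1 2 3 show ?thesis
    by linarith
qed

text \<open>The initial energy bounds both quantities: the quadratic growth of
  \<open>gap_weight\<close> gives the gap rate, and the squared linear growth of
  \<open>weight\<close> the distance rate. Nonnegativity starts at index 1, since the initial primal
  point may lie outside the domain of \<open>G\<close>.\<close>

lemma energy_estimates:
  fixes K :: "'a::real_inner \<Rightarrow> 'b::real_inner"
  assumes K: "bounded_linear K" "\<tau> 0 * \<sigma> 0 * (onorm K)\<^sup>2 < 1"
    and primal: "\<And>i. g (Suc i) - (1 - lam i) * g i
      \<le> - ((lam i)\<^sup>2 / \<tau> i) * ((X (Suc i) - X i) \<bullet> X (Suc i))
        - lam i * \<gamma> * (norm (X (Suc i)))\<^sup>2 - lam i * (K (X (Suc i)) \<bullet> Y i)"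
    and dual: "\<And>i. f (Suc i) - (1 - lam (Suc i)) * f i
      \<le> - ((lam (Suc i))\<^sup>2 / \<sigma> (Suc i)) * ((Y (Suc i) - Y i) \<bullet> Y (Suc i))
        + lam (Suc i) * (K (X (Suc i) + \<omega> i *\<^sub>R (X (Suc i) - X i)) \<bullet> Y (Suc i))"
    and nonneg: "\<And>i. 0 \<le> g (Suc i)" "\<And>i. 0 \<le> f (Suc i)"
  obtains D where "\<And>N. 0 < N \<Longrightarrow> g N + f N \<le> D / (real N)\<^sup>2"
    and "\<And>N. 0 < N \<Longrightarrow> (norm (X N))\<^sup>2 \<le> D / (real N)\<^sup>2"
proof -
  define H where "H i = (weight i)\<^sup>2 / (2 * \<tau> 0) * (norm (X i))\<^sup>2
      + (norm (Y i))\<^sup>2 / (2 * \<sigma> 0) - weight i * (K (X i) \<bullet> Y i)" for i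
  \<comment> \<open>The excesses carry the weights that the next step consumes; by
    \<open>gap_weight_Suc_le\<close> these do not exceed the weights that the previous step
    produced.\<close>
  define E where "E i = gap_weight i * (1 - lam i) * g i
      + gap_weight (Suc i) * (1 - lam (Suc i)) * f i + H i" for i
  define \<kappa> where "\<kappa> = sqrt (\<tau> 0 * \<sigma> 0) * onorm K"
  have \<kappa>: "0 \<le> \<kappa>" "\<kappa> < 1"
  proof -
    show "0 \<le> \<kappa>"
      unfolding \<kappa>_def using init onorm_pos_le[OF K(1)] by simp
    have "\<kappa>\<^sup>2 < 1\<^sup>2"
      unfolding \<kappa>_def using K(2) init by (simp add: power_mult_distrib)
    then show "\<kappa> < 1"
      by (rule power2_less_imp_less) simp
  qed
  \<comment> \<open>The coupling uses up at most the whole \<open>Y\<close> term but only the share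
    \<open>\<kappa>\<close> of the \<open>X\<close> term; as \<open>\<kappa> < 1\<close>, control of
    the primal distance remains.\<close>
  have H: "(1 - \<kappa>) * ((weight i)\<^sup>2 / (2 * \<tau> 0) * (norm (X i))\<^sup>2) \<le> H i" for i
  proof -
    have "weight i * (K (X i) \<bullet> Y i) \<le> \<kappa> * ((weight i)\<^sup>2 / (2 * \<tau> 0) * (norm (X i))\<^sup>2
        + (norm (Y i))\<^sup>2 / (2 * \<sigma> 0))"
      unfolding \<kappa>_def by (rule coupling_bound[OF K(1) init(1,2)])
    moreover have "\<kappa> * ((norm (Y i))\<^sup>2 / (2 * \<sigma> 0)) \<le> 1 * ((norm (Y i))\<^sup>2 / (2 * \<sigma> 0))"
      using \<kappa> init by (intro mult_right_mono) auto
    ultimately show ?thesis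
      unfolding H_def by (simp only: distrib_left left_diff_distrib mult_1)
  qed
  have H_nonneg: "0 \<le> H i" for i
    using H[of i] \<kappa> init by (smt (verit) divide_nonneg_nonneg mult_nonneg_nonneg zero_le_power2)
  have step: "gap_weight i * g (Suc i) + gap_weight (Suc i) * f (Suc i) + H (Suc i) \<le> E i" for i
    using energy_step[OF K(1) less_imp_le[OF K(2)] primal dual, of i]
    unfolding E_def H_def by linarith
  have E_Suc: "E (Suc i) \<le> E i" for i
    using step[of i] mult_right_mono[OF gap_weight_Suc_le nonneg(1), of i i]
      mult_right_mono[OF gap_weight_Suc_le nonneg(2), of "Suc i" i]
    unfolding E_def by linarith
  have "E i \<le> E 0" for i
    by (induction i) (auto intro: order_trans[OF E_Suc])
  with step have bound: "gap_weight i * g (Suc i) + gap_weight (Suc i) * f (Suc i) + H (Suc i) \<le> E 0" for i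
    using order_trans by blast
  have gw: "0 \<le> gap_weight i * g (Suc i)" "0 \<le> gap_weight (Suc i) * f (Suc i)" for i
    using gap_weight_pos nonneg by (simp_all add: less_imp_le)
  have E0: "0 \<le> E 0"
    using bound[of 0] gw[of 0] H_nonneg[of "Suc 0"] by linarith
  obtain C where C: "0 < C" "\<And>i. C * (real (Suc i))\<^sup>2 \<le> gap_weight i"
    using gap_weight_growth by blast
  obtain c where c: "0 < c" "\<And>i. 1 + c * real i \<le> weight i"
    using weight_growth by metis
  define D1 where "D1 = E 0 / C"
  define D2 where "D2 = E 0 / ((1 - \<kappa>) * (c\<^sup>2 / (2 * \<tau> 0)))"
  have gap: "g N + f N \<le> D1 / (real N)\<^sup>2" if "0 < N" for N
  proof -
    obtain i where N: "N = Suc i"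
      using \<open>0 < N\<close> gr0_implies_Suc by blast
    have "gap_weight i \<le> gap_weight (Suc i)"
      using gap_weight_le_Suc[of i] eps weight_pos[of i] mult_nonneg_nonneg[of "1 - \<epsilon>" "weight i"]
      by linarith
    then have "gap_weight i * f N \<le> gap_weight (Suc i) * f N"
      unfolding N using nonneg(2)[of i] by (rule mult_right_mono)
    then have "gap_weight i * (g N + f N) \<le> E 0"
      using bound[of i] H_nonneg[of N] unfolding N distrib_left by linarith
    moreover have "C * (real N)\<^sup>2 * (g N + f N) \<le> gap_weight i * (g N + f N)"
      using C(2)[of i] nonneg[of i] unfolding N by (intro mult_right_mono) auto
    ultimately have "(g N + f N) * (C * (real N)\<^sup>2) \<le> E 0"
      by (simp add: mult.commute)
    then have "g N + f N \<le> E 0 / (C * (real N)\<^sup>2)"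
      using C(1) \<open>0 < N\<close> by (subst pos_le_divide_eq) auto
    then show ?thesis
      unfolding D1_def by simp
  qed
  have dist: "(norm (X N))\<^sup>2 \<le> D2 / (real N)\<^sup>2" if "0 < N" for N
  proof -
    obtain i where N: "N = Suc i"
      using \<open>0 < N\<close> gr0_implies_Suc by blast
    have "(c * real N)\<^sup>2 \<le> (weight N)\<^sup>2"
      using c(1) c(2)[of N] by (intro power_mono) auto
    then have "(1 - \<kappa>) * ((c * real N)\<^sup>2 / (2 * \<tau> 0) * (norm (X N))\<^sup>2)
        \<le> (1 - \<kappa>) * ((weight N)\<^sup>2 / (2 * \<tau> 0) * (norm (X N))\<^sup>2)"
      using \<kappa> init by (intro mult_left_mono mult_right_mono divide_right_mono) auto
    also have "\<dots> \<le> E 0"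
      using H[of N] bound[of i] gw[of i] unfolding N by linarith
    finally have "(norm (X N))\<^sup>2 * ((1 - \<kappa>) * (c\<^sup>2 / (2 * \<tau> 0)) * (real N)\<^sup>2) \<le> E 0"
      by (simp add: power_mult_distrib mult_ac)
    moreover have "0 < (1 - \<kappa>) * (c\<^sup>2 / (2 * \<tau> 0)) * (real N)\<^sup>2"
      using \<kappa> c(1) init \<open>0 < N\<close> by simp
    ultimately have "(norm (X N))\<^sup>2 \<le> E 0 / ((1 - \<kappa>) * (c\<^sup>2 / (2 * \<tau> 0)) * (real N)\<^sup>2)"
      by (simp only: pos_le_divide_eq)
    then show ?thesis
      unfolding D2_def by simp
  qed
  show thesis
  proof (rule that[of "max D1 D2"])
    fix N :: nat assume "0 < N"
    show "g N + f N \<le> max D1 D2 / (real N)\<^sup>2"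
      using gap[OF \<open>0 < N\<close>] by (rule order_trans) (simp add: divide_right_mono)
    show "(norm (X N))\<^sup>2 \<le> max D1 D2 / (real N)\<^sup>2"
      using dist[OF \<open>0 < N\<close>] by (rule order_trans) (simp add: divide_right_mono)
  qed
qed

end

section \<open>Conversion to rates and conclusion\<close>

lemma inverse_square_rate:
  fixes a :: "nat \<Rightarrow> real"
  assumes "\<And>N. 0 < N \<Longrightarrow> 0 \<le> a N" "\<And>N. 0 < N \<Longrightarrow> a N \<le> D / (real N)\<^sup>2"
  shows "a \<in> O(\<lambda>N. 1 / (real N)\<^sup>2)" and "a \<longlonglongrightarrow> 0"
proof -
  have ev: "\<forall>\<^sub>F N in sequentially. 0 \<le> a N \<and> a N \<le> D / (real N)\<^sup>2"
    using eventually_gt_at_top[of "0::nat"] by eventually_elim (use assms in auto)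
  then show "a \<in> O(\<lambda>N. 1 / (real N)\<^sup>2)"
    by (intro bigoI[of _ D]) (auto elim!: eventually_mono)
  have "(\<lambda>N. D * (1 / real N)\<^sup>2) \<longlonglongrightarrow> D * 0\<^sup>2"
    by (intro tendsto_intros lim_1_over_n)
  then have "(\<lambda>N. D / (real N)\<^sup>2) \<longlonglongrightarrow> 0"
    by (simp add: power_divide)
  then show "a \<longlonglongrightarrow> 0"
    by (rule tendsto_sandwich[rotated 3, where f = "\<lambda>_. 0"]) (use ev in \<open>auto elim!: eventually_mono\<close>)
qed

text \<open>The bilinear terms are exactly the linear parts of the two excesses, because the
  contributions \<open>K xh \<bullet> yh\<close> cancel.\<close>

lemma adjusted_gap_eq_reduced_bregman:
  assumes "bounded_linear K" "\<And>u. K u \<bullet> yh = u \<bullet> adjoint K yh"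
    and "proper G" "proper Fs" "G x \<noteq> \<infinity>" "G xh \<noteq> \<infinity>" "Fs y \<noteq> \<infinity>" "Fs yh \<noteq> \<infinity>"
  shows "adjusted_gap \<gamma> \<rho> K G Fs (x, y) (xh, yh)
    = ereal (reduced_bregman \<gamma> G (- adjoint K yh) xh x + reduced_bregman \<rho> Fs (K xh) yh y)"
proof -
  interpret bounded_linear K by fact
  obtain a b c d where "G x = ereal a" "G xh = ereal b" "Fs y = ereal c" "Fs yh = ereal d"
    using assms(3-8) ereal_real_proper by meson
  moreover have "adjoint K yh \<bullet> (x - xh) = yh \<bullet> K x - yh \<bullet> K xh"
    using assms(2)[of "x - xh"] by (simp add: diff inner_diff_left inner_diff_right inner_commute)
  ultimately show ?thesis
    unfolding adjusted_gap_def convexity_reduced_def reduced_bregman_def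
    by (simp add: inner_diff_right inner_commute[of "K xh"] algebra_simps)
qed

theorem theorem4p6:
  fixes K :: "'a::{real_inner, complete_space} \<Rightarrow> 'b::{real_inner, complete_space}"
    and G :: "'a \<Rightarrow> ereal"
    and F Fs :: "'b \<Rightarrow> ereal"
    and \<gamma> \<rho> \<epsilon> :: real
    and \<tau> \<sigma> lam \<mu> \<omega> :: "nat \<Rightarrow> real"
    and x xb xt :: "nat \<Rightarrow> 'a"
    and y yb yt :: "nat \<Rightarrow> 'b"
    and xh :: 'a and yh :: 'b
  assumes K: "bounded_linear K"
    and G: "econvex G" "proper G" "lsc G" "strongly_econvex \<gamma> G"
    and F: "econvex F" "proper F" "lsc F"
    and Fs_conjugate: "Fs = fenchel_conjugate F"
    and Fs: "econvex Fs" "proper Fs" "lsc Fs" "strongly_econvex \<rho> Fs"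
    and factors: "\<gamma> > 0" "\<rho> = 0"
    and eps: "0 \<le> \<epsilon>" "\<epsilon> < 1"
    and steps_init: "\<tau> 0 > 0" "\<sigma> 0 > 0" "\<tau> 0 * \<sigma> 0 * (onorm K)\<^sup>2 < 1"
    and inertial_init: "lam 0 = 1" "\<mu> 0 = 1"
    and tau_update: "\<And>i. \<tau> (Suc i) = \<tau> i * inverse (lam i) * lam (Suc i) * \<omega> i"
    and omega_def: "\<And>i. \<omega> i = (inverse (lam (Suc i)) - 1) / (inverse (lam i) - \<epsilon>)"
    and sigma_update: "\<And>i. \<sigma> (Suc i) = \<sigma> i * inverse (lam i) * lam (Suc i) / \<omega> i"
    and mu_update: "\<And>i. \<mu> (Suc i) = lam (Suc i)"
    and lam_update: "\<And>i. lam (Suc i) =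
          sqrt ((lam i)\<^sup>2 + 2 * \<gamma> * lam i * \<tau> i)
          / (1 - \<epsilon> * lam i + sqrt ((lam i)\<^sup>2 + 2 * \<gamma> * lam i * \<tau> i))"
    and algorithm: "ic_pdps \<gamma> \<rho> K G Fs \<tau> \<sigma> lam \<mu> \<omega> x xb xt y yb yt"
    and solution: "(xh, yh) \<in> saddle_points K G Fs"
  shows "((\<lambda>N. adjusted_gap \<gamma> 0 K G Fs (x N, y N) (xh, yh)) \<longlonglongrightarrow> 0)
       \<and> (\<forall>\<^sub>F N in sequentially. \<bar>adjusted_gap \<gamma> 0 K G Fs (x N, y N) (xh, yh)\<bar> \<noteq> \<infinity>)
       \<and> (\<lambda>N. real_of_ereal (adjusted_gap \<gamma> 0 K G Fs (x N, y N) (xh, yh)))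
            \<in> O(\<lambda>N. 1 / (real N)\<^sup>2)
       \<and> ((\<lambda>N. (norm (aux_seq lam x N - xh))\<^sup>2) \<longlonglongrightarrow> 0)
       \<and> (\<lambda>N. (norm (aux_seq lam x N - xh))\<^sup>2) \<in> O(\<lambda>N. 1 / (real N)\<^sup>2)"
proof -
  interpret accelerated_steps \<gamma> \<epsilon> \<tau> \<sigma> lam \<omega>
    using factors eps steps_init inertial_init tau_update omega_def sigma_update lam_update
    by unfold_locales auto
  interpret alg: ic_pdps \<gamma> \<rho> K G Fs \<tau> \<sigma> lam \<mu> \<omega> x xb xt y yb yt
    by fact
  interpret K: bounded_linear K by fact
  note adj = adjoint_bounded_linear[OF K]
  let ?p = "- adjoint K yh"
  define \<zeta> where "\<zeta> = aux_seq lam x"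
  have p: "?p \<in> subdifferential G xh" and q: "K xh \<in> subdifferential Fs yh"
    using solution unfolding saddle_points_def by auto
  define g where "g i = reduced_bregman \<gamma> G ?p xh (x i)" for i
  define f where "f i = reduced_bregman 0 Fs (K xh) yh (y i)" for i
  have Fs0: "strongly_econvex 0 Fs"
    using Fs(4) factors by simp
  have mu: "\<mu> i = lam i" for i
    using inertial_init mu_update by (cases i) auto
  have xt: "xt i = \<zeta> i" for i
    unfolding \<zeta>_def by (cases i) (simp_all add: alg.x_init alg.xt_step algebra_simps)
  \<comment> \<open>Both base points are brought into the form required by
    \<open>inertial_prox_step\<close>; the primal one uses \<open>lam i\<close>, the dual one
    \<open>lam (Suc i)\<close>.\<close>
  have xb: "xb i = (1 - lam i) *\<^sub>R x i + lam i *\<^sub>R \<zeta> i" for i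
    unfolding \<zeta>_def using init
    by (cases i) (simp_all add: alg.x_init alg.xb_step algebra_simps)
  have yb: "yb i = (1 - lam (Suc i)) *\<^sub>R y i + lam (Suc i) *\<^sub>R yt i" for i
    by (cases i) (simp_all add: alg.y_init alg.yb_step alg.yt_step mu algebra_simps)
  have yt: "yt (Suc i) = inverse (lam (Suc i)) *\<^sub>R y (Suc i) - (inverse (lam (Suc i)) - 1) *\<^sub>R y i" for i
    by (simp add: alg.yt_step mu algebra_simps)
  have x_Suc: "x (Suc i) = prox (corrected_step \<gamma> (\<tau> i) (lam i)) G
      (corrected_base \<gamma> (\<tau> i) (lam i) (xb i) (x i)
        + corrected_step \<gamma> (\<tau> i) (lam i) *\<^sub>R (- adjoint K (yt i)))" for i
    using alg.x_step[of i] by simp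
  have y_Suc: "y (Suc i) = prox (corrected_step 0 (\<sigma> (Suc i)) (lam (Suc i))) Fs
      (corrected_base 0 (\<sigma> (Suc i)) (lam (Suc i)) (yb i) (y i)
        + corrected_step 0 (\<sigma> (Suc i)) (lam (Suc i)) *\<^sub>R
            K (\<zeta> (Suc i) + \<omega> i *\<^sub>R (\<zeta> (Suc i) - \<zeta> i)))" for i
    using alg.y_step[of i] factors by (simp only: mu xt)
  have \<zeta>_Suc: "\<zeta> (Suc i) = inverse (lam i) *\<^sub>R x (Suc i) - (inverse (lam i) - 1) *\<^sub>R x i" for i
    unfolding \<zeta>_def by simp
  note primal_step = inertial_prox_step[OF G less_imp_le[OF gamma_pos] tau_pos lam_pos lam_le_one p
      x_Suc xb \<zeta>_Suc]
  note dual_step = inertial_prox_step[OF Fs(1-3) Fs0 order_refl sigma_pos lam_pos lam_le_one q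
      y_Suc yb yt]
  \<comment> \<open>\<open>x 0\<close> is arbitrary, so \<open>G (x 0)\<close> may be infinite;
    \<open>lam 0 = 1\<close> covers this case, and later iterates are proximal values in the
    domain.\<close>
  have "G (x i) \<noteq> \<infinity> \<or> lam i = 1" for i
    by (induction i) (use init primal_step(1) in auto)
  note x_fin = primal_step(1)[OF this] and primal = primal_step(2)[OF this]
  \<comment> \<open>The first dual step already uses \<open>lam 1\<close>, which is below 1, so
    finiteness at \<open>y 0\<close> has to come from the initialisation.\<close>
  have y_fin: "Fs (y i) \<noteq> \<infinity>" for i
  proof (induction i)
    case 0
    then show ?case
      using alg.y_init(3) subdifferential_finite[OF Fs(2)] unfolding dom_subdifferential_def by auto
  next
    case (Suc i)
    then show ?case by (intro dual_step(1)) auto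
  qed
  note dual = dual_step(2)[OF disjI1[OF y_fin]]
  have g: "0 \<le> g (Suc i)" for i
    unfolding g_def by (rule reduced_bregman_nonneg[OF G(4,2) p x_fin])
  have f: "0 \<le> f (Suc i)" for i
    unfolding f_def by (rule reduced_bregman_nonneg[OF Fs0 Fs(2) q y_fin])
  define X where "X i = \<zeta> i - xh" for i
  define Y where "Y i = yt i - yh" for i
  have 1: "g (Suc i) - (1 - lam i) * g i
      \<le> - ((lam i)\<^sup>2 / \<tau> i) * ((X (Suc i) - X i) \<bullet> X (Suc i))
        - lam i * \<gamma> * (norm (X (Suc i)))\<^sup>2 - lam i * (K (X (Suc i)) \<bullet> Y i)" for i
  proof -
    have "(- adjoint K (yt i) - ?p) \<bullet> X (Suc i) = - (K (X (Suc i)) \<bullet> Y i)"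
      unfolding Y_def inner_diff_right adj by (simp add: inner_diff_left inner_commute[of "X (Suc i)"])
    then show ?thesis
      using primal[of i] unfolding g_def X_def by simp
  qed
  have 2: "f (Suc i) - (1 - lam (Suc i)) * f i
      \<le> - ((lam (Suc i))\<^sup>2 / \<sigma> (Suc i)) * ((Y (Suc i) - Y i) \<bullet> Y (Suc i))
        + lam (Suc i) * (K (X (Suc i) + \<omega> i *\<^sub>R (X (Suc i) - X i)) \<bullet> Y (Suc i))" for i
  proof -
    have "K (\<zeta> (Suc i) + \<omega> i *\<^sub>R (\<zeta> (Suc i) - \<zeta> i)) - K xh
        = K (X (Suc i) + \<omega> i *\<^sub>R (X (Suc i) - X i))"
      unfolding X_def by (simp add: K.add K.diff K.scaleR)
    then show ?thesis
      using dual[of i] unfolding f_def Y_def by simp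
  qed
  obtain D where D: "\<And>N. 0 < N \<Longrightarrow> g N + f N \<le> D / (real N)\<^sup>2"
    "\<And>N. 0 < N \<Longrightarrow> (norm (X N))\<^sup>2 \<le> D / (real N)\<^sup>2"
    using energy_estimates[OF K steps_init(3) 1 2 g f] by blast
  \<comment> \<open>At \<open>N = 0\<close> the gap may be infinite, so it is identified with a real
    number for positive \<open>N\<close> only, hence eventually.\<close>
  have gap: "adjusted_gap \<gamma> 0 K G Fs (x N, y N) (xh, yh) = ereal (g N + f N)" if "0 < N" for N
  proof -
    have "G (x N) \<noteq> \<infinity>"
      using x_fin[of "N - 1"] that by simp
    then show ?thesis
      unfolding g_def f_def
      using subdifferential_finite[OF G(2) p] subdifferential_finite[OF Fs(2) q]
      by (intro adjusted_gap_eq_reduced_bregman[OF K adj G(2) Fs(2)] y_fin)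
  qed
  have ev: "\<forall>\<^sub>F N in sequentially. adjusted_gap \<gamma> 0 K G Fs (x N, y N) (xh, yh) = ereal (g N + f N)"
    using eventually_gt_at_top[of "0::nat"] by eventually_elim (rule gap)
  have "0 \<le> g N + f N" if "0 < N" for N
    using g[of "N - 1"] f[of "N - 1"] that by simp
  note gap_rate = inverse_square_rate[OF this D(1)]
  note dist_rate = inverse_square_rate[OF zero_le_power2 D(2), unfolded X_def \<zeta>_def]
  have "(\<lambda>N. adjusted_gap \<gamma> 0 K G Fs (x N, y N) (xh, yh)) \<longlonglongrightarrow> 0"
    using tendsto_cong[OF ev] gap_rate(2) by (simp add: zero_ereal_def)
  moreover have "\<forall>\<^sub>F N in sequentially. \<bar>adjusted_gap \<gamma> 0 K G Fs (x N, y N) (xh, yh)\<bar> \<noteq> \<infinity>"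
    using ev by eventually_elim simp
  moreover have "(\<lambda>N. real_of_ereal (adjusted_gap \<gamma> 0 K G Fs (x N, y N) (xh, yh)))
      \<in> O(\<lambda>N. 1 / (real N)\<^sup>2)"
  proof -
    have "\<forall>\<^sub>F N in sequentially.
        real_of_ereal (adjusted_gap \<gamma> 0 K G Fs (x N, y N) (xh, yh)) = g N + f N"
      using ev by eventually_elim simp
    from landau_o.big.in_cong[OF this] gap_rate(1) show ?thesis by blast
  qed
  ultimately show ?thesis
    using dist_rate by blast
qed

end
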